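(* Let $\mathcal{H}(T,A,\mu)$ be a Cauchy--de Branges space and $N\in\mathbb{N}$, $N\ge1$. The following are equivalent: (i) $\mathcal{H}(T,A,\mu)$ contains a nearly invariant subspace $\mathcal{H}_0$ of codimension $N$; (ii) the closure of $\mathcal{D}_{z^N}=\{F\in\mathcal{H}(T,A,\mu): z^NF\in\mathcal{H}(T,A,\mu)\}$ is a subspace of codimension $N$; (iii) $\sum_n|t_n|^{2N-2}\mu_n<\infty$. In this case the nearly invariant subspace of codimension $N$ is unique and equals $\overline{\mathcal{D}_{z^N}}=\{B_0,\dots,B_{N-1}\}^\perp$, where $$B_j(z)=A(z)\sum_n\frac{\overline{t_n}^{\,j}\mu_n}{z-t_n},\qquad j=0,\dots,N-1.$$
   Context: Let $T=\{t_n\}_{n\ge1}\subset\mathbb{C}$ be a set of distinct points with $|t_n|\to\infty$, and let $\mu_n>0$ satisfy $\sum_n\frac{\mu_n}{|t_n|^2+1}<\infty$. Let $A$ be an entire function with simple zeros exactly at the points of $T$ and no other zeros. The Cauchy--de Branges space is $\mathcal{H}(T,A,\mu)=\{F(z)=A(z)\sum_n\frac{c_n\mu_n^{1/2}}{z-t_n}:(c_n)\in\ell^2\}$ with norm $\|F\|=\|(c_n)\|_{\ell^2}$. A closed linear subspace $\mathcal{H}_0\subset\mathcal{H}(T,A,\mu)$ is nearly invariant if $f\in\mathcal{H}_0$, $f(w)=0$ imply $\frac{f(z)}{z-w}\in\mathcal{H}_0$. *)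

theory Defs
  imports "HOL-Analysis.Analysis"
begin

text \<open>Sequences are indexed from 0 instead of 1.\<close>

definition l2seq :: "(nat \<Rightarrow> complex) \<Rightarrow> bool" where
  "l2seq c \<longleftrightarrow> summable (\<lambda>n. (cmod (c n))\<^sup>2)"

text \<open>The entire function A(z) sum c_n mu_n^(1/2)/(z - t_n); at z = t_n its value is
  the limit c_n mu_n^(1/2) A'(t_n).\<close>
definition cdb_fun ::
  "(nat \<Rightarrow> complex) \<Rightarrow> (complex \<Rightarrow> complex) \<Rightarrow> (nat \<Rightarrow> real) \<Rightarrow> (nat \<Rightarrow> complex) \<Rightarrow> complex \<Rightarrow> complex" where
  "cdb_fun t A \<mu> c z =
     (if z \<in> range t then c (inv t z) * complex_of_real (sqrt (\<mu> (inv t z))) * deriv A z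
      else A z * (\<Sum>n. c n * complex_of_real (sqrt (\<mu> n)) / (z - t n)))"

definition cdb_space ::
  "(nat \<Rightarrow> complex) \<Rightarrow> (complex \<Rightarrow> complex) \<Rightarrow> (nat \<Rightarrow> real) \<Rightarrow> (complex \<Rightarrow> complex) set" where
  "cdb_space t A \<mu> = {cdb_fun t A \<mu> c | c. l2seq c}"

definition cdb_coeff ::
  "(nat \<Rightarrow> complex) \<Rightarrow> (complex \<Rightarrow> complex) \<Rightarrow> (nat \<Rightarrow> real) \<Rightarrow> (complex \<Rightarrow> complex) \<Rightarrow> nat \<Rightarrow> complex" where
  "cdb_coeff t A \<mu> F = (THE c. l2seq c \<and> F = cdb_fun t A \<mu> c)"

definition cdb_norm ::
  "(nat \<Rightarrow> complex) \<Rightarrow> (complex \<Rightarrow> complex) \<Rightarrow> (nat \<Rightarrow> real) \<Rightarrow> (complex \<Rightarrow> complex) \<Rightarrow> real" where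
  "cdb_norm t A \<mu> F = sqrt (\<Sum>n. (cmod (cdb_coeff t A \<mu> F n))\<^sup>2)"

definition cdb_inner ::
  "(nat \<Rightarrow> complex) \<Rightarrow> (complex \<Rightarrow> complex) \<Rightarrow> (nat \<Rightarrow> real) \<Rightarrow> (complex \<Rightarrow> complex) \<Rightarrow> (complex \<Rightarrow> complex) \<Rightarrow> complex" where
  "cdb_inner t A \<mu> F G = (\<Sum>n. cdb_coeff t A \<mu> F n * cnj (cdb_coeff t A \<mu> G n))"

definition cdb_closure ::
  "(nat \<Rightarrow> complex) \<Rightarrow> (complex \<Rightarrow> complex) \<Rightarrow> (nat \<Rightarrow> real) \<Rightarrow> (complex \<Rightarrow> complex) set \<Rightarrow> (complex \<Rightarrow> complex) set" where
  "cdb_closure t A \<mu> D = {F \<in> cdb_space t A \<mu>. \<exists>X. (\<forall>k. X k \<in> D) \<and>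
       (\<lambda>k. cdb_norm t A \<mu> (\<lambda>z. X k z - F z)) \<longlonglongrightarrow> 0}"

definition cdb_closed_subspace ::
  "(nat \<Rightarrow> complex) \<Rightarrow> (complex \<Rightarrow> complex) \<Rightarrow> (nat \<Rightarrow> real) \<Rightarrow> (complex \<Rightarrow> complex) set \<Rightarrow> bool" where
  "cdb_closed_subspace t A \<mu> H0 \<longleftrightarrow>
     H0 \<subseteq> cdb_space t A \<mu> \<and> (\<lambda>z. 0) \<in> H0 \<and>
     (\<forall>F\<in>H0. \<forall>G\<in>H0. (\<lambda>z. F z + G z) \<in> H0) \<and>
     (\<forall>a. \<forall>F\<in>H0. (\<lambda>z. a * F z) \<in> H0) \<and>
     cdb_closure t A \<mu> H0 \<subseteq> H0"

text \<open>Nearly invariant: closed subspace, and f in H0, f(w) = 0 imply f(z)/(z-w) in H0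
  (the quotient being extended by its limit f'(w) at z = w).\<close>
definition nearly_invariant ::
  "(nat \<Rightarrow> complex) \<Rightarrow> (complex \<Rightarrow> complex) \<Rightarrow> (nat \<Rightarrow> real) \<Rightarrow> (complex \<Rightarrow> complex) set \<Rightarrow> bool" where
  "nearly_invariant t A \<mu> H0 \<longleftrightarrow>
     cdb_closed_subspace t A \<mu> H0 \<and>
     (\<forall>f\<in>H0. \<forall>w. f w = 0 \<longrightarrow> (\<lambda>z. if z = w then deriv f w else f z / (z - w)) \<in> H0)"

definition cdb_codim ::
  "(nat \<Rightarrow> complex) \<Rightarrow> (complex \<Rightarrow> complex) \<Rightarrow> (nat \<Rightarrow> real) \<Rightarrow> (complex \<Rightarrow> complex) set \<Rightarrow> nat \<Rightarrow> bool" where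
  "cdb_codim t A \<mu> H0 N \<longleftrightarrow>
     (\<exists>S. finite S \<and> card S = N \<and> S \<subseteq> cdb_space t A \<mu> \<and>
        (\<forall>a. (\<lambda>z. \<Sum>s\<in>S. a s * s z) \<in> H0 \<longrightarrow> (\<forall>s\<in>S. a s = 0)) \<and>
        (\<forall>F\<in>cdb_space t A \<mu>. \<exists>a. (\<lambda>z. F z - (\<Sum>s\<in>S. a s * s z)) \<in> H0))"

definition D_zpow ::
  "(nat \<Rightarrow> complex) \<Rightarrow> (complex \<Rightarrow> complex) \<Rightarrow> (nat \<Rightarrow> real) \<Rightarrow> nat \<Rightarrow> (complex \<Rightarrow> complex) set" where
  "D_zpow t A \<mu> N = {F \<in> cdb_space t A \<mu>. (\<lambda>z. z ^ N * F z) \<in> cdb_space t A \<mu>}"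

definition B_fun ::
  "(nat \<Rightarrow> complex) \<Rightarrow> (complex \<Rightarrow> complex) \<Rightarrow> (nat \<Rightarrow> real) \<Rightarrow> nat \<Rightarrow> complex \<Rightarrow> complex" where
  "B_fun t A \<mu> j = cdb_fun t A \<mu> (\<lambda>n. cnj (t n) ^ j * complex_of_real (sqrt (\<mu> n)))"

end

theory Submission
  imports Defs "HOL-Computational_Algebra.Fundamental_Theorem_Algebra"
begin

text \<open>
  Let \<open>H\<^sub>0\<close> be nearly invariant of codimension \<open>N\<close>. Among any \<open>N + 1\<close> functions \<open>A(z)/(z - t\<^sub>i)\<close>
  some nontrivial combination \<open>A p/q\<close> lies in \<open>H\<^sub>0\<close>. Dividing out the zeros of \<open>p\<close>, and then
  further points \<open>t\<^sub>i\<close>, which are zeros of \<open>A/q\<close>, shows that \<open>A(z)/\<Prod>(z - t\<^sub>i)\<close> lies in \<open>H\<^sub>0\<close>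
  for every product of \<open>N + 1\<close> distinct factors. The same functions lie in the domain \<open>D\<close> of multiplication by \<open>z\<^sup>N\<close>.
  A closed subspace that contains all of them is, together with \<open>A(z)/(z - t\<^sub>i)\<close>, \<open>i < N\<close>, the whole
  space; if its codimension is exactly \<open>N\<close>, the coordinate of \<open>A(z)/(z - t\<^sub>0)\<close> is a bounded
  functional, and its values on \<open>A(z)/(z - t\<^sub>n)\<close> are those of a Lagrange polynomial of degree \<open>N - 1\<close>
  at \<open>t\<^sub>n\<close>. Boundedness is then the summability condition (iii). Conversely, under (iii) the space
  \<open>{B\<^sub>0, \<dots>, B\<^sub>N\<^sub>-\<^sub>1}\<^sup>\<bottom>\<close> of coefficient sequences with vanishing moments is the closed span of these
  functions, has codimension \<open>N\<close> and is nearly invariant, and \<open>D\<close> is contained in it.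
\<close>

section \<open>Square summable sequences\<close>

definition l2norm :: "(nat \<Rightarrow> complex) \<Rightarrow> real" where
  "l2norm c = sqrt (\<Sum>n. (cmod (c n))\<^sup>2)"

lemma l2seq_comparison:
  assumes "l2seq d" "eventually (\<lambda>n. cmod (c n) \<le> K * cmod (d n)) sequentially"
  shows "l2seq c"
  unfolding l2seq_def
proof (rule summable_comparison_test_ev)
  show "summable (\<lambda>n. K\<^sup>2 * (cmod (d n))\<^sup>2)"
    using assms(1) unfolding l2seq_def by (rule summable_mult)
  show "\<forall>\<^sub>F n in sequentially. norm ((cmod (c n))\<^sup>2) \<le> K\<^sup>2 * (cmod (d n))\<^sup>2"
    using assms(2)
  proof eventually_elim
    case (elim n)
    then have "(cmod (c n))\<^sup>2 \<le> (K * cmod (d n))\<^sup>2" by (intro power_mono) auto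
    then show ?case by (simp add: power_mult_distrib)
  qed
qed

lemma l2seq_add:
  assumes "l2seq c" "l2seq d"
  shows "l2seq (\<lambda>n. c n + d n)"
  unfolding l2seq_def
proof (rule summable_comparison_test)
  show "summable (\<lambda>n. 2 * (cmod (c n))\<^sup>2 + 2 * (cmod (d n))\<^sup>2)"
    using assms unfolding l2seq_def by (intro summable_add summable_mult)
  have "(cmod (c n + d n))\<^sup>2 \<le> 2 * (cmod (c n))\<^sup>2 + 2 * (cmod (d n))\<^sup>2" for n
  proof -
    have "(cmod (c n + d n))\<^sup>2 \<le> (cmod (c n) + cmod (d n))\<^sup>2"
      by (intro power_mono norm_triangle_ineq) auto
    also have "\<dots> \<le> 2 * (cmod (c n))\<^sup>2 + 2 * (cmod (d n))\<^sup>2"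
      using sum_squares_bound[of "cmod (c n)" "cmod (d n)"] by (simp add: power2_sum)
    finally show ?thesis .
  qed
  then show "\<exists>N. \<forall>n\<ge>N. norm ((cmod (c n + d n))\<^sup>2) \<le> 2 * (cmod (c n))\<^sup>2 + 2 * (cmod (d n))\<^sup>2"
    by auto
qed

lemma l2seq_scale: "l2seq c \<Longrightarrow> l2seq (\<lambda>n. a * c n)"
  by (rule l2seq_comparison[where K = "cmod a"]) (auto simp: norm_mult)

lemma l2seq_diff: "l2seq c \<Longrightarrow> l2seq d \<Longrightarrow> l2seq (\<lambda>n. c n - d n)"
  using l2seq_add[of c "\<lambda>n. (-1) * d n"] l2seq_scale[of d "-1"] by simp

lemma l2seq_finite:
  assumes "finite Q" "\<And>n. n \<notin> Q \<Longrightarrow> c n = 0"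
  shows "l2seq c"
  unfolding l2seq_def by (rule summable_finite[of Q]) (use assms in auto)

lemma l2seq_zero [simp]: "l2seq (\<lambda>n. 0)"
  by (simp add: l2seq_def)

lemma l2seq_sum: "finite I \<Longrightarrow> (\<And>i. i \<in> I \<Longrightarrow> l2seq (v i)) \<Longrightarrow> l2seq (\<lambda>n. \<Sum>i\<in>I. a i * v i n)"
  by (induction I rule: finite_induct) (auto intro!: l2seq_add l2seq_scale)

lemma L2_set_le_l2norm: "l2seq c \<Longrightarrow> finite Q \<Longrightarrow> L2_set (\<lambda>n. cmod (c n)) Q \<le> l2norm c"
  unfolding L2_set_def l2norm_def l2seq_def
  by (intro real_sqrt_le_mono sum_le_suminf) auto

text \<open>Transfers bounds from the finite \<open>L2_set\<close>, where Minkowski's inequality is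
  available, to square summable sequences.\<close>

lemma l2norm_leI:
  assumes "l2seq c" "\<And>n. L2_set (\<lambda>n. cmod (c n)) {..<n} \<le> B"
  shows "l2norm c \<le> B"
proof -
  have "B \<ge> 0" using order_trans[OF L2_set_nonneg assms(2)] .
  have "(\<Sum>n. (cmod (c n))\<^sup>2) \<le> B\<^sup>2"
  proof (rule suminf_le_const)
    show "summable (\<lambda>n. (cmod (c n))\<^sup>2)" using assms(1) by (simp add: l2seq_def)
    show "(\<Sum>i<n. (cmod (c i))\<^sup>2) \<le> B\<^sup>2" for n
      using assms(2)[of n] \<open>B \<ge> 0\<close> unfolding L2_set_def by (simp add: real_sqrt_le_iff sqrt_le_D)
  qed
  then show ?thesis unfolding l2norm_def using \<open>B \<ge> 0\<close> by (simp add: real_le_lsqrt)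
qed

lemma l2norm_nonneg: "l2seq c \<Longrightarrow> l2norm c \<ge> 0"
  unfolding l2norm_def l2seq_def by (auto intro!: suminf_nonneg)

lemma l2norm_triangle:
  assumes "l2seq c" "l2seq d"
  shows "l2norm (\<lambda>n. c n + d n) \<le> l2norm c + l2norm d"
proof (rule l2norm_leI[OF l2seq_add[OF assms]])
  fix n
  have "L2_set (\<lambda>n. cmod (c n + d n)) {..<n} \<le> L2_set (\<lambda>n. cmod (c n) + cmod (d n)) {..<n}"
    by (intro L2_set_mono norm_triangle_ineq) auto
  also have "\<dots> \<le> L2_set (\<lambda>n. cmod (c n)) {..<n} + L2_set (\<lambda>n. cmod (d n)) {..<n}"
    by (rule L2_set_triangle_ineq)
  also have "\<dots> \<le> l2norm c + l2norm d"
    using assms by (intro add_mono L2_set_le_l2norm) auto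
  finally show "L2_set (\<lambda>n. cmod (c n + d n)) {..<n} \<le> l2norm c + l2norm d" .
qed

lemma l2norm_scale: "l2seq c \<Longrightarrow> l2norm (\<lambda>n. a * c n) = cmod a * l2norm c"
  by (simp add: l2norm_def l2seq_def norm_mult power_mult_distrib suminf_mult real_sqrt_mult)

lemma l2norm_minus_commute: "l2norm (\<lambda>n. c n - d n) = l2norm (\<lambda>n. d n - c n)"
  by (simp add: l2norm_def norm_minus_commute)

lemma l2norm_triangle3:
  assumes "l2seq a" "l2seq b" "l2seq c"
  shows "l2norm (\<lambda>n. a n - c n) \<le> l2norm (\<lambda>n. a n - b n) + l2norm (\<lambda>n. b n - c n)"
  using l2norm_triangle[of "\<lambda>n. a n - b n" "\<lambda>n. b n - c n"] assms by (simp add: l2seq_diff)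

lemma l2norm_sum_le:
  assumes "finite I" "\<And>i. i \<in> I \<Longrightarrow> l2seq (v i)"
  shows "l2norm (\<lambda>n. \<Sum>i\<in>I. a i * v i n) \<le> (\<Sum>i\<in>I. cmod (a i) * l2norm (v i))"
  using assms
proof (induction I rule: finite_induct)
  case empty
  then show ?case by (simp add: l2norm_def)
next
  case (insert i I)
  have "l2norm (\<lambda>n. a i * v i n + (\<Sum>i\<in>I. a i * v i n))
      \<le> l2norm (\<lambda>n. a i * v i n) + l2norm (\<lambda>n. \<Sum>i\<in>I. a i * v i n)"
    using insert by (intro l2norm_triangle l2seq_scale l2seq_sum) auto
  also have "l2norm (\<lambda>n. a i * v i n) = cmod (a i) * l2norm (v i)"
    using insert by (intro l2norm_scale) auto
  finally show ?case using insert by simp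
qed

lemma l2_mult:
  assumes "l2seq c" "l2seq d"
  shows l2_mult_summable_norm: "summable (\<lambda>n. cmod (c n * d n))"
    and l2_mult_summable: "summable (\<lambda>n. c n * d n)"
    and l2_cauchy_schwarz: "cmod (\<Sum>n. c n * d n) \<le> l2norm c * l2norm d"
proof -
  have bd: "(\<Sum>i<n. cmod (c i * d i)) \<le> l2norm c * l2norm d" for n
  proof -
    have "(\<Sum>i<n. cmod (c i * d i)) \<le> L2_set (\<lambda>n. cmod (c n)) {..<n} * L2_set (\<lambda>n. cmod (d n)) {..<n}"
      using L2_set_mult_ineq[of "\<lambda>n. cmod (c n)" "\<lambda>n. cmod (d n)" "{..<n}"] by (simp add: norm_mult)
    also have "\<dots> \<le> l2norm c * l2norm d"
      using assms by (intro mult_mono L2_set_le_l2norm l2norm_nonneg) (auto simp: L2_set_nonneg)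
    finally show ?thesis .
  qed
  show s: "summable (\<lambda>n. cmod (c n * d n))"
    by (rule summableI_nonneg_bounded[of _ "l2norm c * l2norm d"]) (use bd in auto)
  then show "summable (\<lambda>n. c n * d n)" by (rule summable_norm_cancel)
  show "cmod (\<Sum>n. c n * d n) \<le> l2norm c * l2norm d"
    using summable_norm[OF s] suminf_le_const[OF s bd] by linarith
qed

lemma l2norm_tail:
  assumes "l2seq c"
  shows "(\<lambda>M. l2norm (\<lambda>n. if n < M then 0 else c n)) \<longlonglongrightarrow> 0"
proof -
  have s: "summable (\<lambda>n. (cmod (c n))\<^sup>2)" using assms by (simp add: l2seq_def)
  have "(\<Sum>n. (cmod (if n < M then 0 else c n))\<^sup>2)
      = (\<Sum>n. (cmod (c n))\<^sup>2) - (\<Sum>n<M. (cmod (c n))\<^sup>2)" for M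
  proof -
    have "(\<lambda>n. (if n \<in> {..<M} then (cmod (c n))\<^sup>2 else 0)) sums (\<Sum>n<M. (cmod (c n))\<^sup>2)"
      by (rule sums_If_finite_set) simp
    from sums_diff[OF summable_sums[OF s] this]
    have "(\<lambda>n. (cmod (if n < M then 0 else c n))\<^sup>2) sums
        ((\<Sum>n. (cmod (c n))\<^sup>2) - (\<Sum>n<M. (cmod (c n))\<^sup>2))"
      by (rule sums_cong[THEN iffD1, rotated]) auto
    then show ?thesis by (rule sums_unique[symmetric])
  qed
  moreover have "(\<lambda>M. sqrt ((\<Sum>n. (cmod (c n))\<^sup>2) - (\<Sum>n<M. (cmod (c n))\<^sup>2)))
      \<longlonglongrightarrow> sqrt ((\<Sum>n. (cmod (c n))\<^sup>2) - (\<Sum>n. (cmod (c n))\<^sup>2))"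
    by (intro tendsto_intros summable_LIMSEQ s)
  ultimately show ?thesis by (simp add: l2norm_def)
qed

section \<open>Closures and subspaces of square summable sequences, and finite-dimensional
  extensions of them\<close>

definition l2closure :: "(nat \<Rightarrow> complex) set \<Rightarrow> (nat \<Rightarrow> complex) set" where
  "l2closure X = {c. l2seq c \<and> (\<forall>e>0. \<exists>d\<in>X. l2norm (\<lambda>n. d n - c n) < e)}"

definition l2subspace :: "(nat \<Rightarrow> complex) set \<Rightarrow> bool" where
  "l2subspace X \<longleftrightarrow> (\<forall>c\<in>X. l2seq c) \<and> (\<lambda>n. 0) \<in> X \<and> (\<forall>c\<in>X. \<forall>d\<in>X. (\<lambda>n. c n + d n) \<in> X) \<and>
     (\<forall>a. \<forall>c\<in>X. (\<lambda>n. a * c n) \<in> X)"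

lemma l2subspaceD:
  assumes "l2subspace X"
  shows l2subspace_l2seq: "c \<in> X \<Longrightarrow> l2seq c"
    and l2subspace_zero: "(\<lambda>n. 0) \<in> X"
    and l2subspace_add: "c \<in> X \<Longrightarrow> d \<in> X \<Longrightarrow> (\<lambda>n. c n + d n) \<in> X"
    and l2subspace_scale: "c \<in> X \<Longrightarrow> (\<lambda>n. a * c n) \<in> X"
  using assms by (auto simp: l2subspace_def)

lemma l2subspace_diff: "l2subspace X \<Longrightarrow> c \<in> X \<Longrightarrow> d \<in> X \<Longrightarrow> (\<lambda>n. c n - d n) \<in> X"
  using l2subspace_add[of X c "\<lambda>n. (-1) * d n"] l2subspace_scale[of X d "-1"] by simp

lemma l2subspace_sum:
  assumes "l2subspace X" "finite I" "\<And>i. i \<in> I \<Longrightarrow> v i \<in> X"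
  shows "(\<lambda>n. \<Sum>i\<in>I. a i * v i n) \<in> X"
  using assms(2,3)
proof (induction I rule: finite_induct)
  case empty
  show ?case using l2subspace_zero[OF assms(1)] by simp
next
  case (insert i I)
  have "(\<lambda>n. a i * v i n + (\<Sum>i\<in>I. a i * v i n)) \<in> X"
    using insert by (intro l2subspace_add[OF assms(1)] l2subspace_scale[OF assms(1)]) auto
  then show ?case using insert.hyps by simp
qed

lemma l2closureE:
  assumes "c \<in> l2closure X" "e > 0"
  obtains d where "d \<in> X" "l2norm (\<lambda>n. d n - c n) < e"
  using assms unfolding l2closure_def by blast

lemma l2closure_superset:
  assumes "\<forall>c\<in>X. l2seq c"
  shows "X \<subseteq> l2closure X"
proof
  fix c assume c: "c \<in> X"
  have "l2norm (\<lambda>n. c n - c n) = 0" by (simp add: l2norm_def)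
  then have "\<exists>d\<in>X. l2norm (\<lambda>n. d n - c n) < e" if "e > 0" for e
    using that c by (intro bexI[of _ c]) simp_all
  then show "c \<in> l2closure X" using c assms unfolding l2closure_def by blast
qed

lemma l2closure_mono: "X \<subseteq> Y \<Longrightarrow> l2closure X \<subseteq> l2closure Y"
  unfolding l2closure_def by fast

lemma l2closure_idem:
  assumes "\<forall>c\<in>X. l2seq c"
  shows "l2closure (l2closure X) \<subseteq> l2closure X"
proof
  fix c assume c: "c \<in> l2closure (l2closure X)"
  show "c \<in> l2closure X"
    unfolding l2closure_def
  proof (safe)
    show "l2seq c" using c by (simp add: l2closure_def)
    fix e :: real assume "e > 0"
    then have "e / 2 > 0" by simp
    obtain d where d: "d \<in> l2closure X" "l2norm (\<lambda>n. d n - c n) < e / 2"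
      using l2closureE[OF c \<open>e / 2 > 0\<close>] .
    obtain b where b: "b \<in> X" "l2norm (\<lambda>n. b n - d n) < e / 2"
      using l2closureE[OF d(1) \<open>e / 2 > 0\<close>] .
    have "l2norm (\<lambda>n. b n - c n) < e"
      using l2norm_triangle3[of b d c] b d assms \<open>l2seq c\<close> by (auto simp: l2closure_def)
    then show "\<exists>d\<in>X. l2norm (\<lambda>n. d n - c n) < e" using b by blast
  qed
qed

lemma l2subspace_closure:
  assumes X: "l2subspace X"
  shows "l2subspace (l2closure X)"
proof -
  note l2 = l2subspace_l2seq[OF X]
  have add: "(\<lambda>n. c n + d n) \<in> l2closure X" if c: "c \<in> l2closure X" and d: "d \<in> l2closure X" for c d
    unfolding l2closure_def
  proof safe
    have l: "l2seq c" "l2seq d" using that by (auto simp: l2closure_def)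
    then show "l2seq (\<lambda>n. c n + d n)" by (rule l2seq_add)
    fix e :: real assume "e > 0"
    then have "e / 2 > 0" by simp
    obtain c' where c': "c' \<in> X" "l2norm (\<lambda>n. c' n - c n) < e / 2"
      using l2closureE[OF c \<open>e / 2 > 0\<close>] .
    obtain d' where d': "d' \<in> X" "l2norm (\<lambda>n. d' n - d n) < e / 2"
      using l2closureE[OF d \<open>e / 2 > 0\<close>] .
    have "l2norm (\<lambda>n. (c' n + d' n) - (c n + d n)) < e"
      using l2norm_triangle[of "\<lambda>n. c' n - c n" "\<lambda>n. d' n - d n"] c' d' l l2
      by (simp add: l2seq_diff algebra_simps)
    then show "\<exists>x\<in>X. l2norm (\<lambda>n. x n - (c n + d n)) < e"
      by (intro bexI[of _ "\<lambda>n. c' n + d' n"] l2subspace_add[OF X c'(1) d'(1)])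
  qed
  have scale: "(\<lambda>n. a * c n) \<in> l2closure X" if c: "c \<in> l2closure X" for a c
    unfolding l2closure_def
  proof safe
    have l: "l2seq c" using c by (auto simp: l2closure_def)
    then show "l2seq (\<lambda>n. a * c n)" by (rule l2seq_scale)
    fix e :: real assume "e > 0"
    define k where "k = cmod a + 1"
    have k: "k > 0" by (simp add: k_def add_nonneg_pos)
    obtain c' where c': "c' \<in> X" "l2norm (\<lambda>n. c' n - c n) < e / k"
      using l2closureE[OF c divide_pos_pos[OF \<open>e > 0\<close> k]] .
    have "l2norm (\<lambda>n. a * c' n - a * c n) = cmod a * l2norm (\<lambda>n. c' n - c n)"
      using l2norm_scale[of "\<lambda>n. c' n - c n" a] c' l l2 by (simp add: l2seq_diff algebra_simps)
    also have "\<dots> \<le> k * l2norm (\<lambda>n. c' n - c n)"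
      using c' l l2 by (intro mult_right_mono l2norm_nonneg l2seq_diff) (auto simp: k_def)
    also have "\<dots> < e" using c' k by (simp add: field_simps)
    finally show "\<exists>x\<in>X. l2norm (\<lambda>n. x n - a * c n) < e"
      by (intro bexI[of _ "\<lambda>n. a * c' n"] l2subspace_scale[OF X c'(1)])
  qed
  show ?thesis
    unfolding l2subspace_def
    using add scale l2closure_superset[of X] l2 l2subspace_zero[OF X] by (auto simp: l2closure_def)
qed

text \<open>As \<open>X\<close> is closed, \<open>g\<close> keeps a positive distance from it. Hence
  the coordinate along \<open>g\<close> is a bounded functional on \<open>X\<close> plus the line
  through \<open>g\<close>. This serves twice: for the closedness of finite-dimensional extensions
  and for the summability of the weights.\<close>

lemma closed_dist_pos:
  assumes X: "l2subspace X" "l2closure X \<subseteq> X" and g: "l2seq g" "g \<notin> X"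
  shows "\<exists>\<delta>>0. \<forall>c a. l2seq c \<longrightarrow> (\<lambda>n. c n - a * g n) \<in> X \<longrightarrow> \<delta> * cmod a \<le> l2norm c"
proof -
  have "g \<notin> l2closure X" using X g by blast
  then obtain \<delta> where \<delta>: "\<delta> > 0" "\<And>d. d \<in> X \<Longrightarrow> l2norm (\<lambda>n. d n - g n) \<ge> \<delta>"
    using g by (auto simp: l2closure_def not_less)
  have "\<delta> * cmod a \<le> l2norm c" if c: "l2seq c" "(\<lambda>n. c n - a * g n) \<in> X" for c a
  proof (cases "a = 0")
    case False
    \<comment> \<open>The scaled vector is \<open>g - c/a\<close>, an element of \<open>X\<close> at
      distance \<open>l2norm c / cmod a\<close> from \<open>g\<close>.\<close>
    have "(\<lambda>n. (-1 / a) * (c n - a * g n)) \<in> X" by (rule l2subspace_scale[OF X(1) c(2)])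
    from \<delta>(2)[OF this] have "\<delta> \<le> l2norm (\<lambda>n. (-1 / a) * c n)"
      using False by (simp add: field_simps)
    also have "\<dots> = l2norm c / cmod a" 
      by (subst l2norm_scale[OF c(1)]) (simp add: norm_divide)
    finally show ?thesis using False by (simp add: field_simps)
  qed (simp add: l2norm_nonneg c)
  then show ?thesis using \<delta>(1) by blast
qed

text \<open>The sum of \<open>X\<close> and the span of the \<open>v i\<close>; the coefficients
  need not be unique, since the \<open>v i\<close> may be dependent modulo \<open>X\<close>.\<close>

definition l2plus :: "(nat \<Rightarrow> complex) set \<Rightarrow> 'i set \<Rightarrow> ('i \<Rightarrow> nat \<Rightarrow> complex) \<Rightarrow> (nat \<Rightarrow> complex) set" where
  "l2plus X I v = {c. \<exists>a. (\<lambda>n. c n - (\<Sum>i\<in>I. a i * v i n)) \<in> X}"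

lemma l2subspace_plus:
  assumes X: "l2subspace X" and "finite I" "\<And>i. i \<in> I \<Longrightarrow> l2seq (v i)"
  shows "l2subspace (l2plus X I v)"
  unfolding l2subspace_def
proof (intro conjI ballI allI)
  fix c assume "c \<in> l2plus X I v"
  then obtain a where a: "(\<lambda>n. c n - (\<Sum>i\<in>I. a i * v i n)) \<in> X" by (auto simp: l2plus_def)
  show "l2seq c"
    using l2seq_add[OF l2subspace_l2seq[OF X a] l2seq_sum[of I v a]] assms by simp
  fix b
  show "(\<lambda>n. b * c n) \<in> l2plus X I v"
    using l2subspace_scale[OF X a, of b] unfolding l2plus_def
    by (auto intro!: exI[of _ "\<lambda>i. b * a i"] simp: algebra_simps sum_distrib_left)
next
  fix c d assume "c \<in> l2plus X I v" "d \<in> l2plus X I v"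
  then obtain a b where "(\<lambda>n. c n - (\<Sum>i\<in>I. a i * v i n)) \<in> X" "(\<lambda>n. d n - (\<Sum>i\<in>I. b i * v i n)) \<in> X"
    by (auto simp: l2plus_def)
  from l2subspace_add[OF X this] show "(\<lambda>n. c n + d n) \<in> l2plus X I v"
    unfolding l2plus_def by (auto intro!: exI[of _ "\<lambda>i. a i + b i"] simp: algebra_simps sum.distrib)
next
  show "(\<lambda>n. 0) \<in> l2plus X I v"
    using l2subspace_zero[OF X] unfolding l2plus_def by (auto intro!: exI[of _ "\<lambda>i. 0"])
qed

text \<open>When \<open>g\<close> is outside \<open>X\<close>, boundedness of the coordinate makes
  the coordinates of an approximating sequence Cauchy. They converge, so the components in
  \<open>X\<close> converge as well, to a limit in the closed space \<open>X\<close>.\<close>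

lemma l2closed_plus_line:
  assumes X: "l2subspace X" "l2closure X \<subseteq> X" and g: "l2seq g"
    and c: "c \<in> l2closure {c. \<exists>a. (\<lambda>n. c n - a * g n) \<in> X}"
  shows "\<exists>a. (\<lambda>n. c n - a * g n) \<in> X"
proof (cases "g \<in> X")
  case True
  have "{c. \<exists>a. (\<lambda>n. c n - a * g n) \<in> X} \<subseteq> X"
  proof safe
    fix c a assume "(\<lambda>n. c n - a * g n) \<in> X"
    from l2subspace_add[OF X(1) this l2subspace_scale[OF X(1) True, of a]] show "c \<in> X" by simp
  qed
  then have "c \<in> X" using c X l2closure_mono by blast
  then show ?thesis by (intro exI[of _ 0]) simp
next
  case False
  obtain \<delta> where \<delta>: "\<delta> > 0"
    "\<And>c a. l2seq c \<Longrightarrow> (\<lambda>n. c n - a * g n) \<in> X \<Longrightarrow> \<delta> * cmod a \<le> l2norm c"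
    using closed_dist_pos[OF X g False] by blast
  have lc: "l2seq c" using c by (simp add: l2closure_def)
  have "\<exists>d a. (\<lambda>n. d n - a * g n) \<in> X \<and> l2norm (\<lambda>n. d n - c n) < 1 / Suc k" for k
    using c unfolding l2closure_def by fastforce
  then obtain d a where da: "\<And>k. (\<lambda>n. d k n - a k * g n) \<in> X"
    "\<And>k. l2norm (\<lambda>n. d k n - c n) < 1 / Suc k" by metis
  have ld: "l2seq (d k)" for k
    using l2seq_add[OF l2subspace_l2seq[OF X(1) da(1)[of k]] l2seq_scale[OF g, of "a k"]] by simp
  have lim: "(\<lambda>k. l2norm (\<lambda>n. d k n - c n)) \<longlonglongrightarrow> 0"
    by (rule real_tendsto_sandwich[OF _ _ tendsto_const LIMSEQ_inverse_real_of_nat])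
       (auto intro!: always_eventually less_imp_le[OF da(2)] l2norm_nonneg l2seq_diff ld lc
             simp: inverse_eq_divide simp del: of_nat_Suc)
  have "Cauchy a"
    unfolding Cauchy_def
  proof (intro allI impI)
    fix e :: real assume "e > 0"
    then have "\<forall>\<^sub>F k in sequentially. l2norm (\<lambda>n. d k n - c n) < e * \<delta> / 2"
      using \<delta> by (intro order_tendstoD[OF lim]) simp
    then obtain M where M: "\<And>k. k \<ge> M \<Longrightarrow> l2norm (\<lambda>n. d k n - c n) < e * \<delta> / 2"
      by (auto simp: eventually_sequentially)
    have "dist (a m) (a k) < e" if "m \<ge> M" "k \<ge> M" for m k
    proof -
      have "(\<lambda>n. (d m n - d k n) - (a m - a k) * g n) \<in> X"
        using l2subspace_diff[OF X(1) da(1)[of m] da(1)[of k]] by (simp add: algebra_simps)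
      from \<delta>(2)[OF l2seq_diff[OF ld ld] this]
      have "\<delta> * cmod (a m - a k) \<le> l2norm (\<lambda>n. d m n - d k n)" .
      also have "\<dots> \<le> l2norm (\<lambda>n. d m n - c n) + l2norm (\<lambda>n. d k n - c n)"
        using l2norm_triangle3[OF ld lc ld, of m k] l2norm_minus_commute[of c "d k"] by simp
      also have "\<dots> < \<delta> * e" using M[OF that(1)] M[OF that(2)] by (simp add: field_simps)
      finally show ?thesis using \<delta> by (simp add: dist_norm)
    qed
    then show "\<exists>M. \<forall>m\<ge>M. \<forall>n\<ge>M. dist (a m) (a n) < e" by blast
  qed
  then obtain b where b: "a \<longlonglongrightarrow> b" by (metis Cauchy_convergent convergent_def)
  have "(\<lambda>n. c n - b * g n) \<in> l2closure X"
    unfolding l2closure_def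
  proof safe
    show l: "l2seq (\<lambda>n. c n - b * g n)" using lc g by (intro l2seq_diff l2seq_scale)
    fix e :: real assume "e > 0"
    have "(\<lambda>k. l2norm (\<lambda>n. d k n - c n) + cmod (b - a k) * l2norm g) \<longlonglongrightarrow> 0 + cmod (b - b) * l2norm g"
      by (intro tendsto_intros lim b)
    then have "\<forall>\<^sub>F k in sequentially. l2norm (\<lambda>n. d k n - c n) + cmod (b - a k) * l2norm g < e"
      using \<open>e > 0\<close> by (intro order_tendstoD) auto
    then obtain k where k: "l2norm (\<lambda>n. d k n - c n) + cmod (b - a k) * l2norm g < e"
      by (auto simp: eventually_sequentially)
    have "l2norm (\<lambda>n. (d k n - a k * g n) - (c n - b * g n))
        \<le> l2norm (\<lambda>n. d k n - c n) + cmod (b - a k) * l2norm g"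
      using l2norm_triangle[OF l2seq_diff[OF ld[of k] lc] l2seq_scale[OF g, of "b - a k"]]
      unfolding l2norm_scale[OF g] by (simp add: algebra_simps)
    then show "\<exists>x\<in>X. l2norm (\<lambda>n. x n - (c n - b * g n)) < e"
      using da(1)[of k] k by (intro bexI) auto
  qed
  then show ?thesis using X by blast
qed

lemma l2closed_plus:
  assumes X: "l2subspace X" "l2closure X \<subseteq> X" and "finite I" "\<And>i. i \<in> I \<Longrightarrow> l2seq (v i)"
  shows "l2closure (l2plus X I v) \<subseteq> l2plus X I v"
  using assms(3,4)
proof (induction I rule: finite_induct)
  case empty
  then show ?case using X by (simp add: l2plus_def)
next
  case (insert j I)
  \<comment> \<open>Splits off the vector \<open>v j\<close>, so that the case of a line applies
    over \<open>l2plus X I v\<close>.\<close>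
  have eq: "l2plus X (insert j I) v = {c. \<exists>a. (\<lambda>n. c n - a * v j n) \<in> l2plus X I v}"
  proof (intro set_eqI iffI; clarsimp simp: l2plus_def)
    fix c a assume "(\<lambda>n. c n - (\<Sum>i\<in>insert j I. a i * v i n)) \<in> X"
    then show "\<exists>b a. (\<lambda>n. c n - b * v j n - (\<Sum>i\<in>I. a i * v i n)) \<in> X"
      using insert.hyps by (intro exI[of _ "a j"] exI[of _ a]) (simp add: algebra_simps)
  next
    fix c b a assume "(\<lambda>n. c n - b * v j n - (\<Sum>i\<in>I. a i * v i n)) \<in> X"
    moreover have "(\<Sum>i\<in>I. (a(j := b)) i * v i n) = (\<Sum>i\<in>I. a i * v i n)" for n
      using insert.hyps by (intro sum.cong) auto
    ultimately show "\<exists>a. (\<lambda>n. c n - (\<Sum>i\<in>insert j I. a i * v i n)) \<in> X"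
      using insert.hyps by (intro exI[of _ "a(j := b)"]) (simp add: algebra_simps)
  qed
  show ?case
    unfolding eq
    using l2closed_plus_line[OF l2subspace_plus[OF X(1), of I v] insert.IH] insert
    by blast
qed

text \<open>Multiples of all unit vectors produce every truncation of \<open>c\<close>, and the
  truncations converge to \<open>c\<close>.\<close>

lemma l2_dense_units:
  assumes X: "l2subspace X" "l2closure X \<subseteq> X"
    and unit: "\<And>i. \<exists>a. a \<noteq> 0 \<and> (\<lambda>n. if n = i then a else 0) \<in> X"
    and c: "l2seq c"
  shows "c \<in> X"
proof -
  obtain a where a: "\<And>i. a i \<noteq> 0" "\<And>i. (\<lambda>n. if n = i then a i else 0) \<in> X"
    using unit by metis
  have fin: "(\<lambda>n. if n < M then c n else 0) \<in> X" for M
  proof -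
    have "(\<lambda>n. \<Sum>i<M. (c i / a i) * (if n = i then a i else 0)) \<in> X"
      by (rule l2subspace_sum[OF X(1)]) (use a in auto)
    moreover have "(\<Sum>i<M. (c i / a i) * (if n = i then a i else 0)) = (if n < M then c n else 0)" for n
    proof -
      have "(\<Sum>i<M. (c i / a i) * (if n = i then a i else 0)) = (\<Sum>i<M. if n = i then c i else 0)"
        using a(1) by (intro sum.cong) auto
      then show ?thesis by simp
    qed
    ultimately show ?thesis by simp
  qed
  have "c \<in> l2closure X"
    unfolding l2closure_def
  proof safe
    fix e :: real assume "e > 0"
    then have "\<forall>\<^sub>F M in sequentially. l2norm (\<lambda>n. if n < M then 0 else c n) < e"
      by (rule order_tendstoD[OF l2norm_tail[OF c]])
    then obtain M where M: "l2norm (\<lambda>n. if n < M then 0 else c n) < e"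
      by (auto simp: eventually_sequentially)
    have "l2norm (\<lambda>n. (if n < M then c n else 0) - c n) = l2norm (\<lambda>n. if n < M then 0 else c n)"
      unfolding l2norm_def by (intro arg_cong[of _ _ sqrt] suminf_cong) auto
    then show "\<exists>d\<in>X. l2norm (\<lambda>n. d n - c n) < e" using fin M by metis
  qed (fact c)
  then show ?thesis using X by blast
qed

section \<open>Homogeneous linear systems\<close>

text \<open>Gaussian elimination: one equation is solved for a pivot unknown \<open>k\<close> and
  substituted into the others. All dimension counts modulo a subspace rest on this.\<close>

lemma homogeneous_system:
  fixes M :: "'i \<Rightarrow> 'j \<Rightarrow> complex"
  assumes "finite J" "finite I" "card J < card I"
  shows "\<exists>a. (\<exists>i\<in>I. a i \<noteq> 0) \<and> (\<forall>j\<in>J. (\<Sum>i\<in>I. a i * M i j) = 0)"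
  using assms
proof (induction J arbitrary: I M rule: finite_induct)
  case empty
  then obtain i where "i \<in> I" by fastforce
  then show ?case by (intro exI[of _ "\<lambda>_. 1"]) auto
next
  case (insert j J)
  show ?case
  proof (cases "\<exists>i\<in>I. M i j \<noteq> 0")
    case False
    then have "(\<Sum>i\<in>I. a i * M i j) = 0" for a by (intro sum.neutral) auto
    moreover have "card J < card I" using insert by simp
    ultimately show ?thesis using insert.IH[of I M] insert.prems by auto
  next
    case True
    then obtain k where k: "k \<in> I" "M k j \<noteq> 0" by blast
    have "card J < card (I - {k})" using insert k by simp
    from insert.IH[OF _ this, of "\<lambda>i l. M i l - M i j / M k j * M k l"] insert.prems
    obtain a where a: "\<exists>i\<in>I - {k}. a i \<noteq> 0"
      "\<forall>l\<in>J. (\<Sum>i\<in>I - {k}. a i * (M i l - M i j / M k j * M k l)) = 0" by auto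
    \<comment> \<open>The value at the pivot is forced by equation \<open>j\<close>; in the other
      equations it produces exactly the reduced matrix of the induction hypothesis.\<close>
    define b where "b = a(k := - (\<Sum>i\<in>I - {k}. a i * M i j / M k j))"
    have sum_b: "(\<Sum>i\<in>I. b i * M i l) = (\<Sum>i\<in>I - {k}. a i * (M i l - M i j / M k j * M k l))" for l
    proof -
      have "(\<Sum>i\<in>I. b i * M i l) = b k * M k l + (\<Sum>i\<in>I - {k}. b i * M i l)"
        using k insert.prems by (intro sum.remove) auto
      also have "(\<Sum>i\<in>I - {k}. b i * M i l) = (\<Sum>i\<in>I - {k}. a i * M i l)"
        by (intro sum.cong) (auto simp: b_def)
      finally show ?thesis
        by (simp add: b_def algebra_simps sum_subtractf sum_distrib_right sum_distrib_left)
    qed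
    have "\<exists>i\<in>I. b i \<noteq> 0" using a(1) by (auto simp: b_def)
    moreover have "(\<Sum>i\<in>I. b i * M i l) = 0" if "l \<in> insert j J" for l
      using that a(2) k(2) unfolding sum_b by auto
    ultimately show ?thesis by blast
  qed
qed

section \<open>Cauchy--de Branges spaces\<close>

text \<open>Caratheodory's form of the derivative: continuity of the quotient is enough to identify
  its value at a zero that has been divided out.\<close>

lemma has_field_derivative_root:
  fixes f :: "complex \<Rightarrow> complex"
  assumes "\<And>z. f z = (z - w) * h z" "isCont h w"
  shows "(f has_field_derivative h w) (at w)"
  unfolding CARAT_DERIV by (rule exI[of _ h]) (use assms in auto)

text \<open>Recovers an identity at the single point where dividing by \<open>z - w\<close> says
  nothing.\<close>

lemma isCont_zero_punctured:
  fixes f :: "complex \<Rightarrow> complex"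
  assumes "isCont f w" "\<And>z. z \<noteq> w \<Longrightarrow> f z = 0"
  shows "f w = 0"
proof -
  have "(f \<longlongrightarrow> f w) (at w)" using assms(1) by (simp add: isCont_def)
  moreover have "(f \<longlongrightarrow> 0) (at w)"
    by (rule tendsto_eventually) (use assms(2) in \<open>auto simp: eventually_at_filter\<close>)
  ultimately show ?thesis by (intro tendsto_unique) auto
qed

locale cauchy_de_branges =
  fixes t :: "nat \<Rightarrow> complex" and \<mu> :: "nat \<Rightarrow> real" and A :: "complex \<Rightarrow> complex"
  assumes t_inj: "inj t"
    and t_inf: "filterlim (\<lambda>n. cmod (t n)) at_top sequentially"
    and mu_pos: "\<And>n. \<mu> n > 0"
    and mu_sum: "summable (\<lambda>n. \<mu> n / ((cmod (t n))\<^sup>2 + 1))"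
    and A_entire: "A holomorphic_on UNIV"
    and A_zeros: "\<And>z. A z = 0 \<longleftrightarrow> z \<in> range t"
    and A_simple: "\<And>n. deriv A (t n) \<noteq> 0"
begin

abbreviation E :: "(nat \<Rightarrow> complex) \<Rightarrow> complex \<Rightarrow> complex" where
  "E \<equiv> cdb_fun t A \<mu>"

abbreviation rt :: "nat \<Rightarrow> complex" where
  "rt n \<equiv> complex_of_real (sqrt (\<mu> n))"

lemma rt_nz [simp]: "\<mu> n \<noteq> 0" "rt n \<noteq> 0" "sqrt (\<mu> n) \<noteq> 0"
  using mu_pos[of n] by auto

lemma t_eq_iff [simp]: "t m = t n \<longleftrightarrow> m = n"
  using t_inj by (auto simp: inj_def)

lemma t_large: "eventually (\<lambda>n. cmod (t n) > K) sequentially"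
  using t_inf by (simp add: filterlim_at_top_dense)

lemma A_t [simp]: "A (t n) = 0"
  by (simp add: A_zeros)

lemma A_isCont: "isCont A z"
  using A_entire continuous_on_eq_continuous_at[OF open_UNIV] holomorphic_on_imp_continuous_on by blast

lemma A_deriv: "(A has_field_derivative deriv A z) (at z)"
  using A_entire holomorphic_derivI[OF A_entire open_UNIV] by simp

text \<open>With this, Cauchy-Schwarz makes the Cauchy transform of a square summable sequence
  converge absolutely at every point.\<close>

lemma kernel_l2seq: "l2seq (\<lambda>n. rt n / (z - t n))"
proof -
  have "l2seq (\<lambda>n. complex_of_real (sqrt (\<mu> n / ((cmod (t n))\<^sup>2 + 1))))"
    using mu_sum mu_pos by (auto simp: l2seq_def add_nonneg_pos less_imp_le)
  then show ?thesis
  proof (rule l2seq_comparison)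
    show "\<forall>\<^sub>F n in sequentially. cmod (rt n / (z - t n))
        \<le> 2 * cmod (complex_of_real (sqrt (\<mu> n / ((cmod (t n))\<^sup>2 + 1))))"
      \<comment> \<open>The threshold is chosen so that \<open>cmod (t n) - cmod z\<close> is at
        least half of \<open>cmod (t n) + 1\<close>.\<close>
      using t_large[of "2 * cmod z + 1"]
    proof eventually_elim
      case (elim n)
      have "cmod (z - t n) \<ge> cmod (t n) - cmod z"
        by (metis norm_minus_commute norm_triangle_ineq2)
      then have b: "2 * cmod (z - t n) \<ge> cmod (t n) + 1" using elim by simp
      then have pos: "cmod (z - t n) > 0"
        by (smt (verit) norm_ge_zero)
      have "(cmod (t n))\<^sup>2 + 1 \<le> (cmod (t n) + 1)\<^sup>2" by (simp add: power2_sum)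
      also have "\<dots> \<le> (2 * cmod (z - t n))\<^sup>2" using b by (intro power_mono) auto
      finally have "sqrt ((cmod (t n))\<^sup>2 + 1) \<le> 2 * cmod (z - t n)"
        by (intro real_le_lsqrt) auto
      moreover have "sqrt ((cmod (t n))\<^sup>2 + 1) > 0" by (simp add: add_nonneg_pos)
      ultimately have "sqrt (\<mu> n) / cmod (z - t n) \<le> 2 * (sqrt (\<mu> n) / sqrt ((cmod (t n))\<^sup>2 + 1))"
        using pos mu_pos[of n] by (simp add: field_simps mult_left_mono)
      then show ?case using mu_pos[of n]
        by (simp add: norm_divide real_sqrt_divide)
    qed
  qed
qed

text \<open>If \<open>z = t n\<close>, the \<open>n\<close>-th term is the junk value 0.\<close>

lemma cauchy_summable:
  assumes "l2seq c"
  shows "summable (\<lambda>n. cmod (c n * rt n / (z - t n)))" "summable (\<lambda>n. c n * rt n / (z - t n))"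
  using l2_mult_summable_norm[OF assms kernel_l2seq[of z]] l2_mult_summable[OF assms kernel_l2seq[of z]]
  by simp_all

lemma E_at_t [simp]: "E c (t n) = c n * rt n * deriv A (t n)"
  by (simp add: cdb_fun_def t_inj)

lemma E_off_t: "z \<notin> range t \<Longrightarrow> E c z = A z * (\<Sum>n. c n * rt n / (z - t n))"
  by (simp add: cdb_fun_def)

lemma E_add: "l2seq c \<Longrightarrow> l2seq d \<Longrightarrow> E (\<lambda>n. c n + d n) = (\<lambda>z. E c z + E d z)"
  by (rule ext, simp add: cdb_fun_def)
     (auto simp: algebra_simps add_divide_distrib suminf_add[symmetric] cauchy_summable)

lemma E_scale: "l2seq c \<Longrightarrow> E (\<lambda>n. a * c n) = (\<lambda>z. a * E c z)"
proof (rule ext)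
  fix z assume "l2seq c"
  from suminf_mult[OF cauchy_summable(2)[OF this, of z], of a]
  show "E (\<lambda>n. a * c n) z = a * E c z"
    by (simp add: cdb_fun_def algebra_simps)
qed

lemma E_diff: "l2seq c \<Longrightarrow> l2seq d \<Longrightarrow> E (\<lambda>n. c n - d n) = (\<lambda>z. E c z - E d z)"
  using E_add[of c "\<lambda>n. (-1) * d n"] E_scale[of d "-1"] l2seq_scale[of d "-1"] by simp

lemma E_zero [simp]: "E (\<lambda>n. 0) = (\<lambda>z. 0)"
  by (rule ext) (simp add: cdb_fun_def)

lemma E_sum:
  assumes "finite I" "\<And>i. i \<in> I \<Longrightarrow> l2seq (v i)"
  shows "E (\<lambda>n. \<Sum>i\<in>I. a i * v i n) = (\<lambda>z. \<Sum>i\<in>I. a i * E (v i) z)"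
  using assms
  by (induction I rule: finite_induct) (simp_all add: E_add E_scale l2seq_scale l2seq_sum)

text \<open>The values at the nodes determine the coefficients because the zeros of \<open>A\<close>
  are simple and the weights positive. This makes the description in \<open>cdb_coeff\<close>
  unambiguous.\<close>

lemma E_inject [simp]: "E c = E d \<longleftrightarrow> c = d"
proof
  assume "E c = E d"
  then have "E c (t n) = E d (t n)" for n by simp
  then show "c = d" by (auto simp: A_simple)
qed simp

lemma cdb_space_eq: "cdb_space t A \<mu> = E ` {c. l2seq c}"
  by (auto simp: cdb_space_def)

lemma E_in_space [simp]: "E c \<in> cdb_space t A \<mu> \<longleftrightarrow> l2seq c"
  by (auto simp: cdb_space_eq)

lemma cdb_spaceE:
  assumes "F \<in> cdb_space t A \<mu>"
  obtains c where "l2seq c" "F = E c"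
  using assms by (auto simp: cdb_space_eq)

lemma cdb_coeff_E [simp]: "l2seq c \<Longrightarrow> cdb_coeff t A \<mu> (E c) = c"
  unfolding cdb_coeff_def by (rule the_equality) auto

lemma cdb_norm_E_diff: "l2seq c \<Longrightarrow> l2seq d \<Longrightarrow> cdb_norm t A \<mu> (\<lambda>z. E c z - E d z) = l2norm (\<lambda>n. c n - d n)"
  using cdb_coeff_E[OF l2seq_diff, of c d] by (simp add: E_diff cdb_norm_def l2norm_def)

section \<open>Continuity of the functions in the space\<close>

lemma t_isolated: "\<exists>r>0. \<forall>n. t n \<noteq> z \<longrightarrow> r \<le> dist (t n) z"
proof -
  obtain M where M: "\<And>n. n \<ge> M \<Longrightarrow> cmod (t n) > cmod z + 1"
    using t_large[of "cmod z + 1"] by (auto simp: eventually_sequentially)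
  obtain d where d: "d > 0" "\<forall>x\<in>t ` {..<M}. x \<noteq> z \<longrightarrow> d \<le> dist z x"
    using finite_set_avoid[of "t ` {..<M}" z] by auto
  have "min d 1 \<le> dist (t n) z" if "t n \<noteq> z" for n
  proof (cases "n < M")
    case True
    then show ?thesis using d that by (auto simp: dist_commute)
  next
    case False
    then have "cmod (t n) > cmod z + 1" using M by simp
    then have "dist (t n) z > 1"
      using norm_triangle_ineq2[of "t n" z] by (simp add: dist_norm)
    then show ?thesis by simp
  qed
  then show ?thesis using d by (intro exI[of _ "min d 1"]) auto
qed

text \<open>Near \<open>w\<close> the series converges uniformly by the Weierstrass test; a term
  with its pole at \<open>w\<close> itself vanishes by the assumption on \<open>c\<close>.\<close>

lemma cauchy_transform_isCont:
  assumes c: "l2seq c" "\<And>n. t n = w \<Longrightarrow> c n = 0"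
  shows "isCont (\<lambda>z. \<Sum>n. c n * rt n / (z - t n)) w"
proof -
  obtain r where r: "r > 0" "\<And>n. t n \<noteq> w \<Longrightarrow> r \<le> dist (t n) w"
    using t_isolated by blast
  let ?f = "\<lambda>n z. c n * rt n / (z - t n)"
  \<comment> \<open>Half the isolation radius is used, so that moving from \<open>w\<close> to
    \<open>z\<close> loses at most half of the distance to any other node.\<close>
  have lower: "dist (t n) w \<le> 2 * cmod (z - t n)" if "z \<in> ball w (r / 2)" "t n \<noteq> w" for z n
  proof -
    have "dist (t n) w \<le> dist (t n) z + dist z w" by (rule dist_triangle)
    also have "dist z w < r / 2" using that by (simp add: dist_commute)
    finally show ?thesis using r(2)[OF that(2)] by (simp add: dist_norm norm_minus_commute)
  qed
  have "uniform_limit (ball w (r / 2)) (\<lambda>n z. \<Sum>i<n. ?f i z) (\<lambda>z. \<Sum>n. ?f n z) sequentially"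
  proof (rule Weierstrass_m_test)
    show "summable (\<lambda>n. 2 * cmod (c n * rt n / (w - t n)))"
      by (intro summable_mult cauchy_summable c)
    fix n z assume z: "z \<in> ball w (r / 2)"
    show "cmod (c n * rt n / (z - t n)) \<le> 2 * cmod (c n * rt n / (w - t n))"
    proof (cases "t n = w")
      case False
      have "cmod (w - t n) > 0" using False by simp
      moreover have "cmod (w - t n) \<le> 2 * cmod (z - t n)"
        using lower[OF z False] by (simp add: dist_norm norm_minus_commute)
      moreover have "cmod (z - t n) > 0" using calculation by linarith
      ultimately have "1 / cmod (z - t n) \<le> 2 / cmod (w - t n)"
        by (simp add: divide_simps mult.commute)
      then have "cmod (c n * rt n) * (1 / cmod (z - t n)) \<le> cmod (c n * rt n) * (2 / cmod (w - t n))"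
        by (rule mult_left_mono) simp
      then show ?thesis by (simp add: norm_divide mult.commute)
    qed (use c in simp)
  qed
  then have "continuous_on (ball w (r / 2)) (\<lambda>z. \<Sum>n. ?f n z)"
  proof (rule uniform_limit_theorem[rotated])
    have "continuous_on (ball w (r / 2)) (?f n)" for n
    proof (cases "t n = w")
      case False
      have "z \<noteq> t n" if "z \<in> ball w (r / 2)" for z
        using lower[OF that False] False by (auto simp: dist_norm)
      then show ?thesis by (intro continuous_intros) auto
    qed (use c in simp)
    then show "\<forall>\<^sub>F n in sequentially. continuous_on (ball w (r / 2)) (\<lambda>z. \<Sum>i<n. ?f i z)"
      by (intro always_eventually allI continuous_on_sum) auto
  qed simp
  then show ?thesis using r by (simp add: continuous_on_eq_continuous_at)
qed

lemma eventually_off_t: "eventually (\<lambda>z. z \<notin> range t) (at w)"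
proof -
  obtain r where r: "r > 0" "\<And>n. t n \<noteq> w \<Longrightarrow> r \<le> dist (t n) w"
    using t_isolated by blast
  then have "\<not> dist (t n) w < r" if "t n \<noteq> w" for n using that by (simp add: not_less)
  then show ?thesis unfolding eventually_at using r(1) by (intro exI[of _ r]) auto
qed

lemma E_isCont:
  assumes c: "l2seq c"
  shows "isCont (E c) w"
proof (cases "w \<in> range t")
  case False
  have "((\<lambda>z. A z * (\<Sum>n. c n * rt n / (z - t n))) \<longlongrightarrow> A w * (\<Sum>n. c n * rt n / (w - t n))) (at w)"
    using cauchy_transform_isCont[OF c, of w] A_isCont[of w] False
    by (intro tendsto_mult) (auto simp: isCont_def)
  then have "(E c \<longlongrightarrow> A w * (\<Sum>n. c n * rt n / (w - t n))) (at w)"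
    by (rule Lim_transform_eventually) (rule eventually_mono[OF eventually_off_t], simp add: E_off_t)
  then show ?thesis using False by (simp add: isCont_def E_off_t)
next
  case True
  then obtain m where m: "w = t m" by blast
  \<comment> \<open>Without its coefficient at \<open>m\<close> the transform is continuous at
    \<open>t m\<close>. The removed term carries the simple pole; times \<open>A\<close> it tends to
    the value that \<open>cdb_fun\<close> prescribes at a node.\<close>
  define d where "d = c(m := 0)"
  have d: "l2seq d" by (rule l2seq_comparison[OF c, of _ 1]) (auto simp: d_def)
  have "((\<lambda>z. c m * rt m * (A z / (z - t m)) + A z * (\<Sum>n. d n * rt n / (z - t n)))
      \<longlongrightarrow> c m * rt m * deriv A w + A w * (\<Sum>n. d n * rt n / (w - t n))) (at w)"
  proof (intro tendsto_intros)
    show "((\<lambda>z. A z / (z - t m)) \<longlongrightarrow> deriv A w) (at w)"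
      using A_deriv[of w] by (simp add: has_field_derivative_iff m)
    show "(A \<longlongrightarrow> A w) (at w)" using A_isCont by (simp add: isCont_def)
    show "((\<lambda>z. \<Sum>n. d n * rt n / (z - t n)) \<longlongrightarrow> (\<Sum>n. d n * rt n / (w - t n))) (at w)"
      using cauchy_transform_isCont[OF d, of w] by (auto simp: isCont_def m d_def)
  qed
  then have "(E c \<longlongrightarrow> c m * rt m * deriv A w + A w * (\<Sum>n. d n * rt n / (w - t n))) (at w)"
  proof (rule Lim_transform_eventually)
    have "c m * rt m * (A z / (z - t m)) + A z * (\<Sum>n. d n * rt n / (z - t n)) = E c z"
      if "z \<notin> range t" for z
    proof -
      have "(\<lambda>n. d n * rt n / (z - t n) + (if n = m then c m * rt m / (z - t m) else 0)) sums
          ((\<Sum>n. d n * rt n / (z - t n)) + c m * rt m / (z - t m))"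
        by (intro sums_add summable_sums cauchy_summable d sums_single)
      moreover have "d n * rt n / (z - t n) + (if n = m then c m * rt m / (z - t m) else 0)
          = c n * rt n / (z - t n)" for n by (simp add: d_def)
      ultimately have "(\<Sum>n. c n * rt n / (z - t n))
          = (\<Sum>n. d n * rt n / (z - t n)) + c m * rt m / (z - t m)"
        by (simp add: sums_iff)
      then show ?thesis using that by (simp add: E_off_t algebra_simps)
    qed
    then show "\<forall>\<^sub>F z in at w. c m * rt m * (A z / (z - t m)) + A z * (\<Sum>n. d n * rt n / (z - t n)) = E c z"
      by (intro eventually_mono[OF eventually_off_t])
  qed
  then show ?thesis by (simp add: isCont_def m)
qed

section \<open>Multiplication and division by \<open>z - w\<close>\<close>

text \<open>Since (z - w)/(z - t_n) = 1 + (t_n - w)/(z - t_n), multiplying by \<open>z - w\<close>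
  changes the coefficients as stated and adds \<open>A z\<close> times the sum of
  \<open>y n * rt n\<close>, which is zero here.\<close>

lemma E_mult_root:
  assumes y: "l2seq y" and c: "\<And>n. c n = (t n - w) * y n"
    and s: "(\<lambda>n. y n * rt n) sums 0"
  shows "E c z = (z - w) * E y z"
proof (cases "z \<in> range t")
  case True
  then show ?thesis using c by auto
next
  case False
  then have nz: "z - t n \<noteq> 0" for n by auto
  have "(\<lambda>n. (z - w) * (y n * rt n / (z - t n)) - y n * rt n) sums
      ((z - w) * (\<Sum>n. y n * rt n / (z - t n)) - 0)"
    by (intro sums_diff s sums_mult summable_sums cauchy_summable y)
  moreover have "(z - w) * (y n * rt n / (z - t n)) - y n * rt n = c n * rt n / (z - t n)" for n
    using nz[of n] by (simp add: c field_simps)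
  ultimately have "(\<Sum>n. c n * rt n / (z - t n)) = (z - w) * (\<Sum>n. y n * rt n / (z - t n))"
    by (simp add: sums_iff)
  then show ?thesis using False by (simp add: E_off_t)
qed

text \<open>The quotient has coefficients \<open>c n / (t n - w)\<close>. For \<open>w\<close> off
  the nodes, \<open>E c w = 0\<close> says precisely that their zeroth moment vanishes. For
  \<open>w = t m\<close> the coefficient at \<open>m\<close> is free and is chosen to make that
  moment vanish.\<close>

lemma E_root_quotient:
  assumes c: "l2seq c" and root: "E c w = 0"
  shows "\<exists>y. l2seq y \<and> (\<forall>n. c n = (t n - w) * y n) \<and> (\<lambda>n. y n * rt n) sums 0 \<and>
    (\<lambda>z. if z = w then deriv (E c) w else E c z / (z - w)) = E y"
proof -
  have "\<exists>y. l2seq y \<and> (\<forall>n. c n = (t n - w) * y n) \<and> (\<lambda>n. y n * rt n) sums 0"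
  proof -
    define y0 where "y0 n = c n / (t n - w)" for n
    have y0: "l2seq y0"
    proof (rule l2seq_comparison[OF c])
      show "\<forall>\<^sub>F n in sequentially. cmod (y0 n) \<le> 1 * cmod (c n)"
        using t_large[of "cmod w + 1"]
      proof eventually_elim
        case (elim n)
        have "cmod (t n - w) \<ge> 1" using elim norm_triangle_ineq2[of "t n" w] by simp
        then have "cmod (c n) / cmod (t n - w) \<le> cmod (c n) / 1"
          by (intro divide_left_mono) auto
        then show ?case by (simp add: y0_def norm_divide)
      qed
    qed
    have "(\<lambda>n. - (c n * rt n / (w - t n))) sums (- (\<Sum>n. c n * rt n / (w - t n)))"
      by (intro sums_minus summable_sums cauchy_summable c)
    moreover have "- (c n * rt n / (w - t n)) = y0 n * rt n" for n
      by (cases "t n = w") (simp_all add: y0_def divide_simps algebra_simps)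
    ultimately have s: "(\<lambda>n. y0 n * rt n) sums (- (\<Sum>n. c n * rt n / (w - t n)))" by simp
    show ?thesis
    proof (cases "w \<in> range t")
      case False
      then have "(\<Sum>n. c n * rt n / (w - t n)) = 0"
        using root A_zeros by (simp add: E_off_t)
      moreover have "c n = (t n - w) * y0 n" for n using False by (auto simp: y0_def)
      ultimately show ?thesis using s y0 by auto
    next
      case True
      then obtain m where m: "w = t m" by blast
      have cm: "c m = 0" using root A_simple[of m] by (simp add: m)
      \<comment> \<open>The moment of \<open>y0\<close> equals \<open>- \<sigma> * rt m\<close>, so
        the entry \<open>\<sigma>\<close> at \<open>m\<close> cancels it.\<close>
      define \<sigma> where "\<sigma> = (\<Sum>n. c n * rt n / (w - t n)) / rt m"
      define y where "y n = y0 n + (if n = m then \<sigma> else 0)" for n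
      have "l2seq y" unfolding y_def
        by (intro l2seq_add y0 l2seq_finite[of "{m}"]) auto
      moreover have "c n = (t n - w) * y n" for n
        by (cases "n = m") (auto simp: y_def y0_def cm m)
      moreover have "(\<lambda>n. y0 n * rt n + (if n = m then \<sigma> * rt m else 0)) sums
          (- (\<Sum>n. c n * rt n / (w - t n)) + \<sigma> * rt m)"
        by (intro sums_add s sums_single)
      moreover have "(\<lambda>n. y0 n * rt n + (if n = m then \<sigma> * rt m else 0)) = (\<lambda>n. y n * rt n)"
        by (auto simp: y_def algebra_simps)
      ultimately show ?thesis by (auto simp: \<sigma>_def)
    qed
  qed
  then obtain y where y: "l2seq y" "\<And>n. c n = (t n - w) * y n" "(\<lambda>n. y n * rt n) sums 0" by blast
  have eq: "E c z = (z - w) * E y z" for z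
    using E_mult_root[OF y] .
  \<comment> \<open>The value filled in at \<open>w\<close> is the right one because
    \<open>E y\<close> is continuous there.\<close>
  have "deriv (E c) w = E y w"
    using has_field_derivative_root[OF eq E_isCont[OF y(1)]] by (rule DERIV_imp_deriv)
  then have "(\<lambda>z. if z = w then deriv (E c) w else E c z / (z - w)) = E y"
    by (auto simp: eq)
  then show ?thesis using y by blast
qed

section \<open>Closures and closed subspaces expressed by coefficient sequences\<close>

lemma cdb_closure_E:
  assumes X: "\<forall>c\<in>X. l2seq c"
  shows "cdb_closure t A \<mu> (E ` X) = E ` l2closure X"
proof (intro set_eqI iffI)
  fix F assume "F \<in> cdb_closure t A \<mu> (E ` X)"
  then obtain c G where c: "l2seq c" "F = E c" and G: "\<And>k. G k \<in> E ` X"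
    "(\<lambda>k. cdb_norm t A \<mu> (\<lambda>z. G k z - F z)) \<longlonglongrightarrow> 0"
    by (auto simp: cdb_closure_def elim!: cdb_spaceE)
  have "\<forall>k. \<exists>d. d \<in> X \<and> G k = E d" using G(1) by (auto simp: image_iff)
  then obtain d where d: "\<And>k. d k \<in> X" "\<And>k. G k = E (d k)" by (auto dest!: choice)
  have lim: "(\<lambda>k. l2norm (\<lambda>n. d k n - c n)) \<longlonglongrightarrow> 0"
    using G(2) d X c by (simp add: cdb_norm_E_diff)
  have "\<exists>d\<in>X. l2norm (\<lambda>n. d n - c n) < e" if "e > 0" for e
    using order_tendstoD(2)[OF lim that] d(1) by (auto simp: eventually_sequentially)
  then have "c \<in> l2closure X" using c unfolding l2closure_def by blast
  then show "F \<in> E ` l2closure X" using c by blast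
next
  fix F assume "F \<in> E ` l2closure X"
  then obtain c where c: "c \<in> l2closure X" "F = E c" by blast
  have l: "l2seq c" using c by (simp add: l2closure_def)
  \<comment> \<open>The epsilon form of \<open>l2closure\<close> is turned into the sequence that
    \<open>cdb_closure\<close> asks for, with errors below 1/(k+1).\<close>
  have "\<exists>d. d \<in> X \<and> l2norm (\<lambda>n. d n - c n) < 1 / Suc k" for k
  proof -
    have "1 / real (Suc k) > 0" by simp
    then show ?thesis using l2closureE[OF c(1)] by blast
  qed
  then obtain d where d: "\<And>k. d k \<in> X" "\<And>k. l2norm (\<lambda>n. d k n - c n) < 1 / Suc k" by metis
  have "(\<lambda>k. l2norm (\<lambda>n. d k n - c n)) \<longlonglongrightarrow> 0"
    by (rule real_tendsto_sandwich[OF _ _ tendsto_const LIMSEQ_inverse_real_of_nat])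
       (use d X l in \<open>auto intro!: always_eventually less_imp_le[OF d(2)] l2norm_nonneg l2seq_diff
             simp: inverse_eq_divide simp del: of_nat_Suc\<close>)
  then have "(\<lambda>k. cdb_norm t A \<mu> (\<lambda>z. E (d k) z - F z)) \<longlonglongrightarrow> 0"
    using d X l c by (simp add: cdb_norm_E_diff)
  then show "F \<in> cdb_closure t A \<mu> (E ` X)"
    unfolding cdb_closure_def using d l c by (intro CollectI conjI exI[of _ "\<lambda>k. E (d k)"]) auto
qed

lemma cdb_closed_subspace_E:
  assumes "X \<subseteq> {c. l2seq c}"
  shows "cdb_closed_subspace t A \<mu> (E ` X) \<longleftrightarrow> l2subspace X \<and> l2closure X \<subseteq> X"
proof -
  have l2: "l2seq c" if "c \<in> X" for c using assms that by blast
  have img: "E c \<in> E ` X \<longleftrightarrow> c \<in> X" for c by (simp add: inj_image_mem_iff inj_def)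
  have 1: "(\<forall>F\<in>E ` X. \<forall>G\<in>E ` X. (\<lambda>z. F z + G z) \<in> E ` X) \<longleftrightarrow> (\<forall>c\<in>X. \<forall>d\<in>X. (\<lambda>n. c n + d n) \<in> X)"
    by (simp add: l2 E_add[symmetric] img)
  have 2: "(\<forall>a. \<forall>F\<in>E ` X. (\<lambda>z. a * F z) \<in> E ` X) \<longleftrightarrow> (\<forall>a. \<forall>c\<in>X. (\<lambda>n. a * c n) \<in> X)"
    by (simp add: l2 E_scale[symmetric] img)
  have 3: "(\<lambda>z. 0) \<in> E ` X \<longleftrightarrow> (\<lambda>n. 0) \<in> X"
    using img[of "\<lambda>n. 0"] by simp
  have 4: "cdb_closure t A \<mu> (E ` X) \<subseteq> E ` X \<longleftrightarrow> l2closure X \<subseteq> X"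
    using cdb_closure_E[of X] l2 by (simp add: inj_image_subset_iff inj_def)
  have 5: "E ` X \<subseteq> cdb_space t A \<mu>" "\<forall>c\<in>X. l2seq c"
    using l2 by auto
  show ?thesis
    unfolding cdb_closed_subspace_def l2subspace_def 1 2 3 4 using 5 by auto
qed

lemma closed_subspaceE:
  assumes "cdb_closed_subspace t A \<mu> H0"
  obtains X where "H0 = E ` X" "l2subspace X" "l2closure X \<subseteq> X"
proof -
  have "H0 = E ` {c. l2seq c \<and> E c \<in> H0}" (is "_ = E ` ?X")
    using assms by (auto simp: cdb_closed_subspace_def elim!: cdb_spaceE)
  then show ?thesis using that[of ?X] cdb_closed_subspace_E[of ?X] assms by auto
qed

subsection \<open>Lagrange interpolation at the first nodes\<close>


definition lag :: "nat \<Rightarrow> nat \<Rightarrow> complex \<Rightarrow> complex" where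
  "lag N i z = (\<Prod>j\<in>{..<N} - {i}. (z - t j) / (t i - t j))"

lemma lag_node: "i < N \<Longrightarrow> k < N \<Longrightarrow> lag N i (t k) = (if i = k then 1 else 0)"
  unfolding lag_def by (auto intro!: prod.neutral prod_zero)

lemma lag_poly:
  assumes "i < N"
  shows "\<exists>p. degree p < N \<and> (\<forall>z. poly p z = lag N i z)"
proof (intro exI conjI allI)
  define p where "p = (\<Prod>j\<in>{..<N} - {i}. smult (1 / (t i - t j)) [:- t j, 1:])"
  have "degree p \<le> (\<Sum>j\<in>{..<N} - {i}. degree (smult (1 / (t i - t j)) [:- t j, 1:]))"
    unfolding p_def by (rule order_trans[OF degree_prod_sum_le]) (simp_all add: o_def)
  also have "\<dots> \<le> (\<Sum>j\<in>{..<N} - {i}. 1)" by (intro sum_mono) simp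
  also have "\<dots> < N" using assms by simp
  finally show "degree p < N" .
  show "poly p z = lag N i z" for z
    unfolding p_def lag_def poly_prod by (intro prod.cong) (simp_all add: divide_simps)
qed

text \<open>Both sides are polynomials of degree below \<open>N\<close> in \<open>z\<close> and
  agree at the \<open>N\<close> distinct nodes.\<close>

lemma lag_exact:
  assumes "j < N"
  shows "(\<Sum>i<N. t i ^ j * lag N i z) = z ^ j"
proof -
  have "\<forall>i\<in>{..<N}. \<exists>p. degree p < N \<and> (\<forall>z. poly p z = lag N i z)"
    using lag_poly by blast
  then obtain p where p: "\<And>i. i < N \<Longrightarrow> degree (p i) < N" "\<And>i z. i < N \<Longrightarrow> poly (p i) z = lag N i z"
    by (auto dest!: bchoice)
  define P where "P = (\<Sum>i<N. smult (t i ^ j) (p i))"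
  have "degree P < N"
    unfolding P_def using assms p(1)
    by (intro degree_sum_less) (auto intro: le_less_trans[OF degree_smult_le])
  have P: "poly P z = (\<Sum>i<N. t i ^ j * lag N i z)" for z
    unfolding P_def poly_sum by (intro sum.cong) (simp_all add: p)
  have "P = monom 1 j"
  proof (rule poly_eqI_degree[of "t ` {..<N}"])
    have card: "card (t ` {..<N}) = N" using t_inj by (simp add: card_image inj_on_subset)
    then show "degree P < card (t ` {..<N})" using \<open>degree P < N\<close> by simp
    show "degree (monom (1::complex) j) < card (t ` {..<N})"
      unfolding card using assms by (simp add: degree_monom_eq)
    fix x assume "x \<in> t ` {..<N}"
    then obtain k where k: "k < N" "x = t k" by blast
    have "(\<Sum>i<N. t i ^ j * lag N i (t k)) = (\<Sum>i<N. if i = k then t i ^ j else 0)"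
      using k by (intro sum.cong) (auto simp: lag_node)
    then show "poly P x = poly (monom 1 j) x" using k by (simp add: P poly_monom)
  qed
  then show ?thesis using P[of z] by (simp add: poly_monom)
qed

text \<open>\<open>u i\<close> is the coefficient sequence of \<open>A(z)/(z - t\<^sub>i)\<close>, and \<open>g N n\<close> is, up to a nonzero factor, that of
  \<open>A(z)/((z - t\<^sub>0) \<cdots> (z - t\<^sub>N\<^sub>-\<^sub>1)(z - t\<^sub>n))\<close> for \<open>n \<ge> N\<close>; for \<open>n < N\<close> it vanishes.\<close>

definition u :: "nat \<Rightarrow> nat \<Rightarrow> complex" where
  "u i = (\<lambda>n. if n = i then 1 / rt i else 0)"

definition g :: "nat \<Rightarrow> nat \<Rightarrow> nat \<Rightarrow> complex" where
  "g N n = (\<lambda>m. u n m - (\<Sum>i<N. lag N i (t n) * u i m))"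

lemma u_l2seq [simp]: "l2seq (u i)"
  by (rule l2seq_finite[of "{i}"]) (auto simp: u_def)

lemma E_u: "(z - t i) * E (u i) z = A z"
proof (cases "z \<in> range t")
  case True
  then show ?thesis by (auto simp: u_def)
next
  case False
  have "(\<lambda>n. u i n * rt n / (z - t n)) = (\<lambda>n. if n = i then 1 / (z - t n) else 0)"
    by (auto simp: u_def)
  then have "(\<lambda>n. u i n * rt n / (z - t n)) sums (1 / (z - t i))"
    using sums_single[of i "\<lambda>n. 1 / (z - t n)"] by simp
  then have "E (u i) z = A z * (1 / (z - t i))"
    using False by (simp add: E_off_t sums_iff)
  then show ?thesis using False by auto
qed

lemma u_moment: "(\<lambda>m. u i m * rt m * t m ^ j) sums t i ^ j"
proof -
  have "(\<lambda>m. u i m * rt m * t m ^ j) = (\<lambda>m. if m = i then t m ^ j else 0)"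
    by (auto simp: u_def)
  then show ?thesis using sums_single[of i "\<lambda>m. t m ^ j"] by simp
qed

text \<open>The \<open>j\<close>-th moment of \<open>u i\<close> is \<open>t i ^ j\<close>, and
  interpolation at the first \<open>N\<close> nodes reproduces the value of the \<open>j\<close>-th
  power at \<open>t n\<close>.\<close>

lemma g_moment:
  assumes "j < N"
  shows "(\<lambda>m. g N n m * rt m * t m ^ j) sums 0"
proof -
  have "(\<lambda>m. u n m * rt m * t m ^ j - (\<Sum>i<N. lag N i (t n) * (u i m * rt m * t m ^ j))) sums
      (t n ^ j - (\<Sum>i<N. lag N i (t n) * t i ^ j))"
    by (intro sums_diff sums_sum sums_mult u_moment)
  moreover have "(\<Sum>i<N. lag N i (t n) * t i ^ j) = t n ^ j"
    using lag_exact[OF assms, of "t n"] by (simp add: mult.commute)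
  moreover have "g N n m * rt m * t m ^ j
      = u n m * rt m * t m ^ j - (\<Sum>i<N. lag N i (t n) * (u i m * rt m * t m ^ j))" for m
    by (simp add: g_def algebra_simps sum_distrib_left sum_distrib_right)
  ultimately show ?thesis by simp
qed

lemma g_support: "m \<notin> insert n {..<N} \<Longrightarrow> g N n m = 0"
  by (auto simp: g_def u_def intro!: sum.neutral)

lemma g_eq_0: "n < N \<Longrightarrow> g N n = (\<lambda>m. 0)"
proof -
  assume "n < N"
  then have "(\<Sum>i<N. lag N i (t n) * u i m) = (\<Sum>i<N. if i = n then u i m else 0)" for m
    by (intro sum.cong) (auto simp: lag_node)
  then show ?thesis using \<open>n < N\<close> by (simp add: g_def)
qed

section \<open>Multiplication by powers of \<open>z\<close> and vanishing moments\<close>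

text \<open>Iterates \<open>E_mult_root\<close> with \<open>w = 0\<close>: passing from
  \<open>k\<close> to \<open>k + 1\<close> factors consumes the vanishing of the \<open>k\<close>-th
  moment.\<close>

lemma power_mult_in_space:
  assumes "\<And>k. l2seq (\<lambda>n. t n ^ k * y n)" "\<And>j. j < N \<Longrightarrow> (\<lambda>n. y n * rt n * t n ^ j) sums 0"
  shows "k \<le> N \<Longrightarrow> z ^ k * E y z = E (\<lambda>n. t n ^ k * y n) z"
proof (induction k)
  case (Suc k)
  have "E (\<lambda>n. t n ^ Suc k * y n) z = (z - 0) * E (\<lambda>n. t n ^ k * y n) z"
  proof (rule E_mult_root)
    show "(\<lambda>n. t n ^ k * y n * rt n) sums 0"
      using assms(2)[of k] Suc.prems by (simp add: mult_ac)
  qed (use assms(1) in auto)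
  then show ?case using Suc by simp
qed simp

lemma g_in_D_zpow: "E (g N n) \<in> D_zpow t A \<mu> N"
proof -
  have l2: "l2seq (\<lambda>m. t m ^ k * g N n m)" for k
    by (rule l2seq_finite[of "insert n {..<N}"]) (use g_support[of _ n N] in auto)
  have "(\<lambda>z. z ^ N * E (g N n) z) = E (\<lambda>m. t m ^ N * g N n m)"
    using power_mult_in_space[OF l2 g_moment order.refl] by auto
  then show ?thesis using l2[of 0] l2[of N] by (simp add: D_zpow_def)
qed

text \<open>Convergence of the moments is included through \<open>sums 0\<close>, because before
  (iii) is known the moment series of a square summable sequence may diverge. Under (iii) these are
  the coefficients of the functions orthogonal to all \<open>B_fun t A \<mu> j\<close> with
  \<open>j < N\<close>.\<close>

definition moment_free :: "nat \<Rightarrow> (nat \<Rightarrow> complex) set" where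
  "moment_free N = {c. l2seq c \<and> (\<forall>j<N. (\<lambda>n. c n * rt n * t n ^ j) sums 0)}"

text \<open>If \<open>z ^ N * E c z = E d z\<close>, the nodes give
  \<open>d n = t n ^ N * c n\<close>. Off the nodes the difference of the two Cauchy transforms is a
  polynomial in \<open>z\<close> whose coefficients are the moments of \<open>c\<close>; it vanishes
  there, so all of them are zero.\<close>

lemma D_zpow_moment_free:
  assumes "F \<in> D_zpow t A \<mu> N"
  shows "F \<in> E ` moment_free N"
proof -
  obtain c d where c: "l2seq c" "F = E c" and d: "l2seq d" "(\<lambda>z. z ^ N * F z) = E d"
    using assms by (auto simp: D_zpow_def elim!: cdb_spaceE)
  have eq: "z ^ N * E c z = E d z" for z using d(2) c(2) by (metis (no_types))
  have dn: "d n = t n ^ N * c n" for n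
    using eq[of "t n"] by (simp add: A_simple)
  \<comment> \<open>For nodes of modulus above 1, \<open>j < N\<close> bounds the
    \<open>j\<close>-th moment series by the Cauchy transform of \<open>d\<close> at the
    origin.\<close>
  have sm: "summable (\<lambda>n. c n * rt n * t n ^ j)" if "j < N" for j
  proof (rule summable_comparison_test_ev)
    show "summable (\<lambda>n. cmod (d n * rt n / (0 - t n)))" by (rule cauchy_summable[OF d(1)])
    show "\<forall>\<^sub>F n in sequentially. norm (c n * rt n * t n ^ j) \<le> cmod (d n * rt n / (0 - t n))"
      using t_large[of 1]
    proof eventually_elim
      case (elim n)
      have "cmod (t n) ^ j \<le> cmod (t n) ^ (N - 1)"
        using elim that by (intro power_increasing) auto
      also have "\<dots> = cmod (t n) ^ N / cmod (t n)"
        using elim that by (cases N) auto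
      finally have "cmod (c n * rt n) * cmod (t n) ^ j \<le> cmod (c n * rt n) * (cmod (t n) ^ N / cmod (t n))"
        by (intro mult_left_mono) auto
      then show ?case by (simp add: dn norm_mult norm_divide norm_power algebra_simps)
    qed
  qed
  define m where "m j = (\<Sum>n. c n * rt n * t n ^ j)" for j
  have m: "(\<lambda>n. c n * rt n * t n ^ j) sums m j" if "j < N" for j
    using sm[OF that] by (simp add: m_def summable_sums)
  \<comment> \<open>The moments appear in reversed order, from (z^N - t^N)/(z - t) = sum of
    z^(N-1-i) t^i over i < N.\<close>
  define P where "P = (\<Sum>i<N. monom (m i) (N - Suc i))"
  have P0: "poly P z = 0" if z: "z \<notin> range t" for z
  proof -
    have nz: "t n - z \<noteq> 0" for n using z by auto
    have "(\<lambda>n. z ^ N * (c n * rt n / (z - t n)) - d n * rt n / (z - t n)) sums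
        (z ^ N * (\<Sum>n. c n * rt n / (z - t n)) - (\<Sum>n. d n * rt n / (z - t n)))"
      by (intro sums_diff sums_mult summable_sums cauchy_summable c d)
    moreover have "z ^ N * (\<Sum>n. c n * rt n / (z - t n)) = (\<Sum>n. d n * rt n / (z - t n))"
      using eq[of z] z A_zeros by (simp add: E_off_t)
    moreover have "z ^ N * (c n * rt n / (z - t n)) - d n * rt n / (z - t n)
        = (\<Sum>i<N. z ^ (N - Suc i) * (c n * rt n * t n ^ i))" for n
    proof -
      have "z ^ N * (c n * rt n / (z - t n)) - d n * rt n / (z - t n)
          = c n * rt n * ((z ^ N - t n ^ N) / (z - t n))"
        by (simp add: dn diff_divide_distrib right_diff_distrib mult_ac)
      also have "(z ^ N - t n ^ N) / (z - t n) = (t n ^ N - z ^ N) / (t n - z)"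
        using minus_divide_divide[of "t n ^ N - z ^ N" "t n - z"] by simp
      also have "(t n ^ N - z ^ N) / (t n - z) = (\<Sum>i<N. z ^ (N - Suc i) * t n ^ i)"
        using nz[of n] by (simp add: power_diff_sumr2)
      finally show ?thesis by (simp add: sum_distrib_left mult_ac)
    qed
    ultimately have "(\<lambda>n. \<Sum>i<N. z ^ (N - Suc i) * (c n * rt n * t n ^ i)) sums 0" by simp
    moreover have "(\<lambda>n. \<Sum>i<N. z ^ (N - Suc i) * (c n * rt n * t n ^ i)) sums
        (\<Sum>i<N. z ^ (N - Suc i) * m i)"
      by (intro sums_sum sums_mult m) auto
    ultimately have "(\<Sum>i<N. z ^ (N - Suc i) * m i) = 0" by (rule sums_unique2[symmetric])
    then show ?thesis by (simp add: P_def poly_sum poly_monom mult.commute)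
  qed
  have "P = 0"
  proof (rule ccontr)
    assume "P \<noteq> 0"
    then have "finite {z. poly P z = 0}" by (rule poly_roots_finite)
    \<comment> \<open>The nodes together with finitely many roots cannot exhaust the uncountable
      plane.\<close>
    then have "countable (range t \<union> {z. poly P z = 0})" by (simp add: countable_finite)
    moreover have "range t \<union> {z. poly P z = 0} = UNIV" using P0 by blast
    ultimately show False using uncountable_UNIV_complex by simp
  qed
  have "m i = 0" if "i < N" for i
  proof -
    have "coeff P (N - Suc i) = (\<Sum>k<N. if k = i then m k else 0)"
      unfolding P_def coeff_sum using that by (intro sum.cong) auto
    then show ?thesis using that \<open>P = 0\<close> by simp
  qed
  then have "c \<in> moment_free N" using m c by (auto simp: moment_free_def)
  then show ?thesis using c by blast
qed

subsection \<open>Codimension\<close>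

lemma closed_subspace_sum:
  assumes "cdb_closed_subspace t A \<mu> H0" "finite I" "\<And>i. i \<in> I \<Longrightarrow> v i \<in> H0"
  shows "(\<lambda>z. \<Sum>i\<in>I. a i * v i z) \<in> H0"
  using assms(2,3)
proof (induction I rule: finite_induct)
  case empty
  then show ?case using assms(1) by (simp add: cdb_closed_subspace_def)
next
  case (insert i I)
  have "(\<lambda>z. a i * v i z) \<in> H0" "(\<lambda>z. \<Sum>i\<in>I. a i * v i z) \<in> H0"
    using assms(1) insert by (auto simp: cdb_closed_subspace_def)
  then show ?case using assms(1) insert.hyps by (simp add: cdb_closed_subspace_def)
qed

text \<open>Modulo \<open>H0\<close> every \<open>v i\<close> is a combination of \<open>N\<close>
  functions, so more than \<open>N\<close> of them are dependent.\<close>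

lemma codim_dependent:
  assumes H0: "cdb_closed_subspace t A \<mu> H0" "cdb_codim t A \<mu> H0 N"
    and I: "finite I" "N < card I" "\<And>i. i \<in> I \<Longrightarrow> v i \<in> cdb_space t A \<mu>"
  shows "\<exists>a. (\<exists>i\<in>I. a i \<noteq> 0) \<and> (\<lambda>z. \<Sum>i\<in>I. a i * v i z) \<in> H0"
proof -
  obtain S where S: "finite S" "card S = N"
    "\<And>F. F \<in> cdb_space t A \<mu> \<Longrightarrow> \<exists>a. (\<lambda>z. F z - (\<Sum>s\<in>S. a s * s z)) \<in> H0"
    using H0(2) unfolding cdb_codim_def by blast
  have "\<forall>i\<in>I. \<exists>a. (\<lambda>z. v i z - (\<Sum>s\<in>S. a s * s z)) \<in> H0" using S(3) I(3) by blast
  then obtain \<alpha> where \<alpha>: "\<And>i. i \<in> I \<Longrightarrow> (\<lambda>z. v i z - (\<Sum>s\<in>S. \<alpha> i s * s z)) \<in> H0"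
    by (auto dest!: bchoice)
  obtain a where a: "\<exists>i\<in>I. a i \<noteq> 0" "\<forall>s\<in>S. (\<Sum>i\<in>I. a i * \<alpha> i s) = 0"
    using homogeneous_system[of S I \<alpha>] S I by auto
  have "(\<lambda>z. \<Sum>i\<in>I. a i * (v i z - (\<Sum>s\<in>S. \<alpha> i s * s z))) \<in> H0"
    by (rule closed_subspace_sum[OF H0(1) I(1) \<alpha>])
  moreover have "(\<Sum>i\<in>I. a i * (v i z - (\<Sum>s\<in>S. \<alpha> i s * s z))) = (\<Sum>i\<in>I. a i * v i z)" for z
  proof -
    have "(\<Sum>i\<in>I. a i * (v i z - (\<Sum>s\<in>S. \<alpha> i s * s z)))
        = (\<Sum>i\<in>I. a i * v i z) - (\<Sum>i\<in>I. \<Sum>s\<in>S. a i * \<alpha> i s * s z)"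
      by (simp add: right_diff_distrib sum_subtractf sum_distrib_left mult.assoc)
    also have "(\<Sum>i\<in>I. \<Sum>s\<in>S. a i * \<alpha> i s * s z) = (\<Sum>s\<in>S. (\<Sum>i\<in>I. a i * \<alpha> i s) * s z)"
      by (subst sum.swap) (simp add: sum_distrib_right)
    also have "\<dots> = 0" using a(2) by simp
    finally show ?thesis by simp
  qed
  ultimately show ?thesis using a(1) by auto
qed

text \<open>The opposite dimension count: \<open>N\<close> functions independent modulo
  \<open>H0\<close> do not fit into the span of fewer.\<close>

lemma codim_le_span:
  assumes H0: "cdb_closed_subspace t A \<mu> H0" "cdb_codim t A \<mu> H0 N"
    and J: "finite J" "\<And>F. F \<in> cdb_space t A \<mu> \<Longrightarrow> \<exists>b. (\<lambda>z. F z - (\<Sum>j\<in>J. b j * v j z)) \<in> H0"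
  shows "N \<le> card J"
proof (rule ccontr)
  assume "\<not> N \<le> card J"
  obtain S where S: "finite S" "card S = N" "S \<subseteq> cdb_space t A \<mu>"
    "\<And>a. (\<lambda>z. \<Sum>s\<in>S. a s * s z) \<in> H0 \<Longrightarrow> \<forall>s\<in>S. a s = 0"
    using H0(2) unfolding cdb_codim_def by blast
  have "\<forall>s\<in>S. \<exists>b. (\<lambda>z. s z - (\<Sum>j\<in>J. b j * v j z)) \<in> H0" using S(3) J(2) by blast
  then obtain \<beta> where \<beta>: "\<And>s. s \<in> S \<Longrightarrow> (\<lambda>z. s z - (\<Sum>j\<in>J. \<beta> s j * v j z)) \<in> H0"
    by (auto dest!: bchoice)
  obtain a where a: "\<exists>s\<in>S. a s \<noteq> 0" "\<forall>j\<in>J. (\<Sum>s\<in>S. a s * \<beta> s j) = 0"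
    using homogeneous_system[of J S \<beta>] S J \<open>\<not> N \<le> card J\<close> by auto
  have "(\<lambda>z. \<Sum>s\<in>S. a s * (s z - (\<Sum>j\<in>J. \<beta> s j * v j z))) \<in> H0"
    by (rule closed_subspace_sum[OF H0(1) S(1) \<beta>])
  moreover have "(\<Sum>s\<in>S. a s * (s z - (\<Sum>j\<in>J. \<beta> s j * v j z))) = (\<Sum>s\<in>S. a s * s z)" for z
  proof -
    have "(\<Sum>s\<in>S. a s * (s z - (\<Sum>j\<in>J. \<beta> s j * v j z)))
        = (\<Sum>s\<in>S. a s * s z) - (\<Sum>s\<in>S. \<Sum>j\<in>J. a s * \<beta> s j * v j z)"
      by (simp add: right_diff_distrib sum_subtractf sum_distrib_left mult.assoc)
    also have "(\<Sum>s\<in>S. \<Sum>j\<in>J. a s * \<beta> s j * v j z) = (\<Sum>j\<in>J. (\<Sum>s\<in>S. a s * \<beta> s j) * v j z)"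
      by (subst sum.swap) (simp add: sum_distrib_right)
    also have "\<dots> = 0" using a(2) by simp
    finally show ?thesis by simp
  qed
  ultimately show False using a(1) S(4) by simp
qed

subsection \<open>Nearly invariant subspaces\<close>

text \<open>\<open>F\<close> is \<open>A * p / q\<close> with denominators cleared. A root
  \<open>w\<close> of \<open>p\<close> is no zero of \<open>q\<close>, hence a zero of
  \<open>F\<close>, and near invariance divides \<open>F\<close> and \<open>p\<close> by
  \<open>z - w\<close> at once. Induction on the degree ends at a nonzero constant.\<close>

lemma nearly_invariant_divide:
  assumes H0: "nearly_invariant t A \<mu> H0" and q: "\<And>z. isCont q z"
  shows "F \<in> H0 \<Longrightarrow> (\<And>z. q z * F z = A z * poly p z) \<Longrightarrow> p \<noteq> 0 \<Longrightarrow>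
    (\<And>z. q z = 0 \<Longrightarrow> poly p z \<noteq> 0) \<Longrightarrow> \<exists>G\<in>H0. \<forall>z. q z * G z = A z"
proof (induction "degree p" arbitrary: p F)
  case 0
  then obtain a where a: "p = [:a:]" by (metis degree_eq_zeroE)
  have "(\<lambda>z. (1 / a) * F z) \<in> H0"
    using H0 "0.prems"(1) unfolding nearly_invariant_def cdb_closed_subspace_def by blast
  moreover have "q z * ((1 / a) * F z) = A z" for z
    using "0.prems"(2)[of z] "0.prems"(3) a by (simp add: field_simps)
  ultimately show ?case by (intro bexI[of _ "\<lambda>z. (1 / a) * F z"]) auto
next
  case (Suc k)
  have "\<not> constant (poly p)" using Suc.hyps(2) by (simp add: constant_degree)
  then obtain w where w: "poly p w = 0" using fundamental_theorem_of_algebra by blast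
  then obtain r where r: "p = [:- w, 1:] * r" by (metis dvdE poly_eq_0_iff_dvd)
  have r0: "r \<noteq> 0" using Suc.prems(3) r by auto
  have deg: "k = degree r" using Suc.hyps(2) r0 unfolding r by (subst (asm) degree_mult_eq) auto
  have "q w \<noteq> 0" using Suc.prems(4) w by blast
  then have Fw: "F w = 0" using Suc.prems(2)[of w] w by simp
  define G where "G = (\<lambda>z. if z = w then deriv F w else F z / (z - w))"
  have G: "G \<in> H0" using H0 Suc.prems(1) Fw unfolding nearly_invariant_def G_def by blast
  then have "G \<in> cdb_space t A \<mu>" using H0 by (auto simp: nearly_invariant_def cdb_closed_subspace_def)
  then have cont: "isCont G w" by (elim cdb_spaceE) (simp add: E_isCont)
  have off: "q z * G z - A z * poly r z = 0" if "z \<noteq> w" for z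
    using Suc.prems(2)[of z] that by (simp add: G_def r field_simps)
  \<comment> \<open>At \<open>w\<close> the divided identity is obtained by continuity from the
    punctured plane.\<close>
  have "q w * G w - A w * poly r w = 0"
    by (rule isCont_zero_punctured[where f = "\<lambda>z. q z * G z - A z * poly r z"])
       (intro continuous_intros q cont A_isCont, fact off)
  with off have "q z * G z = A z * poly r z" for z by (cases "z = w") auto
  then show ?case
    using Suc.prems(4) r by (intro Suc.hyps(1)[OF deg G _ r0]) auto
qed

text \<open>\<open>A / q\<close> still vanishes at every node that is not a zero of
  \<open>q\<close>, so near invariance adds the factors one by one.\<close>

lemma nearly_invariant_extend:
  assumes H0: "nearly_invariant t A \<mu> H0" and "finite R" "\<And>m. m \<in> R \<Longrightarrow> q (t m) \<noteq> 0"
    and "G \<in> H0" "\<And>z. q z * G z = A z"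
  shows "\<exists>G\<in>H0. \<forall>z. q z * (\<Prod>m\<in>R. z - t m) * G z = A z"
  using assms(2,3)
proof (induction R rule: finite_induct)
  case empty
  then show ?case using assms by auto
next
  case (insert m R)
  then obtain F where F: "F \<in> H0" "\<And>z. q z * (\<Prod>m\<in>R. z - t m) * F z = A z" by auto
  have "(\<Prod>i\<in>R. t m - t i) \<noteq> 0" using insert.hyps by auto
  then have Fm: "F (t m) = 0" using F(2)[of "t m"] insert.prems by auto
  have "q z * (\<Prod>i\<in>insert m R. z - t i) * (if z = t m then deriv F (t m) else F z / (z - t m)) = A z" for z
    using F(2)[of z] insert.hyps by (auto simp: mult.assoc)
  moreover have "(\<lambda>z. if z = t m then deriv F (t m) else F z / (z - t m)) \<in> H0"
    using H0 F(1) Fm unfolding nearly_invariant_def by blast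
  ultimately show ?case by (intro bexI) auto
qed

text \<open>A dependence among the \<open>E (u i)\<close> modulo \<open>H0\<close> is an element
  \<open>A * p / q\<close> of \<open>H0\<close>. The roots of \<open>p\<close> are divided out
  first, and then the factors of \<open>Q\<close> missing from \<open>q\<close> are
  supplied.\<close>

lemma nearly_invariant_contains_inverse:
  assumes H0: "nearly_invariant t A \<mu> H0" "cdb_codim t A \<mu> H0 N" and Q: "finite Q" "N < card Q"
  shows "\<exists>G\<in>H0. \<forall>z. (\<Prod>i\<in>Q. z - t i) * G z = A z"
proof -
  have cs: "cdb_closed_subspace t A \<mu> H0" using H0 by (simp add: nearly_invariant_def)
  obtain a where a: "\<exists>i\<in>Q. a i \<noteq> 0" "(\<lambda>z. \<Sum>i\<in>Q. a i * E (u i) z) \<in> H0" (is "?F \<in> _")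
    using codim_dependent[OF cs H0(2) Q, of "\<lambda>i. E (u i)"] by auto
  \<comment> \<open>Nodes with zero coefficient must stay out of \<open>q\<close>, since otherwise
    \<open>p\<close> and \<open>q\<close> would share a zero there.\<close>
  define R where "R = {i \<in> Q. a i \<noteq> 0}"
  have R: "finite R" "R \<noteq> {}" "R \<subseteq> Q" using Q a by (auto simp: R_def)
  define p where "p = (\<Sum>i\<in>R. smult (a i) (\<Prod>j\<in>R - {i}. [:- t j, 1:]))"
  define q where "q z = (\<Prod>i\<in>R. z - t i)" for z
  have poly_p: "poly p z = (\<Sum>i\<in>R. a i * (\<Prod>j\<in>R - {i}. z - t j))" for z
    by (simp add: p_def poly_sum poly_prod)
  have p_node: "poly p (t k) \<noteq> 0" if "k \<in> R" for k
  proof -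
    have "poly p (t k) = (\<Sum>i\<in>R. if i = k then a k * (\<Prod>j\<in>R - {k}. t k - t j) else 0)"
      unfolding poly_p using R that by (intro sum.cong) (auto intro!: prod_zero)
    also have "\<dots> = a k * (\<Prod>j\<in>R - {k}. t k - t j)" using R that by simp
    finally show ?thesis using that R by (auto simp: R_def)
  qed
  have "q z * ?F z = A z * poly p z" for z
  proof -
    have "?F z = (\<Sum>i\<in>R. a i * E (u i) z)"
      using Q by (intro sum.mono_neutral_right) (auto simp: R_def)
    then have "q z * ?F z = (\<Sum>i\<in>R. a i * (q z * E (u i) z))"
      by (simp add: sum_distrib_left mult_ac)
    also have "\<dots> = (\<Sum>i\<in>R. a i * ((\<Prod>j\<in>R - {i}. z - t j) * A z))"
    proof (intro sum.cong refl)
      fix i assume "i \<in> R"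
      then have "q z = (z - t i) * (\<Prod>j\<in>R - {i}. z - t j)"
        unfolding q_def using R by (intro prod.remove) auto
      then show "a i * (q z * E (u i) z) = a i * ((\<Prod>j\<in>R - {i}. z - t j) * A z)"
        using E_u[of z i] by (simp add: mult_ac)
    qed
    finally show ?thesis by (simp add: poly_p sum_distrib_left mult_ac)
  qed
  moreover have "isCont q z" for z unfolding q_def by (intro continuous_intros)
  moreover have "p \<noteq> 0" using p_node R by (metis all_not_in_conv poly_0)
  moreover have "poly p z \<noteq> 0" if "q z = 0" for z
    using that p_node R by (auto simp: q_def)
  ultimately obtain G where G: "G \<in> H0" "\<And>z. q z * G z = A z"
    using nearly_invariant_divide[OF H0(1) _ a(2), of q p] by blast
  have "\<exists>G\<in>H0. \<forall>z. q z * (\<Prod>m\<in>Q - R. z - t m) * G z = A z"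
    by (rule nearly_invariant_extend[OF H0(1) _ _ G]) (use Q R in \<open>auto simp: q_def\<close>)
  moreover have "(\<Prod>i\<in>Q. z - t i) = q z * (\<Prod>m\<in>Q - R. z - t m)" for z
    unfolding q_def using prod.subset_diff[OF R(3) Q(1), of "\<lambda>i. z - t i"] by (simp add: mult.commute)
  ultimately show ?thesis by simp
qed

text \<open>Partial fractions. At a node in \<open>Q\<close>, the continuous function
  \<open>h\<close> with \<open>A z = (z - t m) * h z\<close> takes the value
  \<open>deriv A (t m)\<close>, which yields the residue; at any other node the function
  vanishes.\<close>

lemma coefficients_of_inverse:
  assumes Q: "finite Q" and c: "l2seq c" and eq: "\<And>z. (\<Prod>i\<in>Q. z - t i) * E c z = A z"
  shows "c m = (if m \<in> Q then 1 / ((\<Prod>i\<in>Q - {m}. t m - t i) * rt m) else 0)"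
proof (cases "m \<in> Q")
  case False
  then have "(\<Prod>i\<in>Q. t m - t i) \<noteq> 0" using Q by auto
  then have "E c (t m) = 0" using eq[of "t m"] by simp
  then show ?thesis using False A_simple by simp
next
  case True
  define h where "h z = (\<Prod>i\<in>Q - {m}. z - t i) * E c z" for z
  have "A z = (z - t m) * h z" for z
    using eq[of z] True Q by (simp add: h_def prod.remove[of Q m] mult.assoc)
  moreover have "isCont h (t m)"
    unfolding h_def by (intro continuous_intros E_isCont c)
  ultimately have "(A has_field_derivative h (t m)) (at (t m))"
    by (rule has_field_derivative_root)
  then have "deriv A (t m) = h (t m)" by (rule DERIV_imp_deriv)
  then have "((\<Prod>i\<in>Q - {m}. t m - t i) * (c m * rt m)) * deriv A (t m) = 1 * deriv A (t m)"
    by (simp only: h_def E_at_t mult.assoc mult_1_left)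
  then have "(\<Prod>i\<in>Q - {m}. t m - t i) * (c m * rt m) = 1"
    using mult_right_cancel[OF A_simple[of m]] by blast
  moreover from this have "(\<Prod>i\<in>Q - {m}. t m - t i) \<noteq> 0" by (metis mult_zero_left zero_neq_one)
  ultimately show ?thesis using True by (simp add: field_simps)
qed

text \<open>For \<open>n \<ge> N\<close>, the vector \<open>g N n\<close> is a multiple of the
  coefficient sequence of \<open>A\<close> divided by the \<open>N + 1\<close> factors for
  \<open>insert n {..<N}\<close>.\<close>

lemma nearly_invariant_contains_g:
  assumes H0: "nearly_invariant t A \<mu> H0" "cdb_codim t A \<mu> H0 N"
  shows "E (g N n) \<in> H0"
proof (cases "n < N")
  case True
  then show ?thesis using H0 by (simp add: g_eq_0 nearly_invariant_def cdb_closed_subspace_def)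
next
  case False
  define Q where "Q = insert n {..<N}"
  have Q: "finite Q" "N < card Q" using False by (auto simp: Q_def)
  obtain G where G: "G \<in> H0" "\<And>z. (\<Prod>i\<in>Q. z - t i) * G z = A z"
    using nearly_invariant_contains_inverse[OF H0 Q] by blast
  moreover have "G \<in> cdb_space t A \<mu>"
    using G H0 by (auto simp: nearly_invariant_def cdb_closed_subspace_def)
  ultimately obtain c where c: "l2seq c" "E c \<in> H0" "\<And>z. (\<Prod>i\<in>Q. z - t i) * E c z = A z"
    by (auto elim!: cdb_spaceE)
  note cm = coefficients_of_inverse[OF Q(1) c(1,3)]
  \<comment> \<open>This factor normalises the coefficient at \<open>n\<close> to that of
    \<open>u n\<close>, namely \<open>1 / rt n\<close>.\<close>
  define r where "r = (\<Prod>i<N. t n - t i)"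
  have r: "r \<noteq> 0" using False by (auto simp: r_def)
  have "g N n = (\<lambda>m. r * c m)"
  proof
    fix m
    show "g N n m = r * c m"
    proof (cases "m \<in> Q")
      case mQ: True
      show ?thesis
      proof (cases "m = n")
        case True
        have "Q - {n} = {..<N}" using False by (auto simp: Q_def)
        moreover have "(\<Sum>i<N. lag N i (t n) * u i n) = 0"
          using False by (intro sum.neutral) (auto simp: u_def)
        ultimately show ?thesis
          using True mQ r cm[of n] by (simp add: g_def u_def r_def)
      next
        case mn: False
        then have m: "m < N" using mQ by (auto simp: Q_def)
        have QM: "Q - {m} = insert n ({..<N} - {m})" using mn by (auto simp: Q_def)
        have r_eq: "r = (t n - t m) * (\<Prod>i\<in>{..<N} - {m}. t n - t i)"
          unfolding r_def using m by (intro prod.remove) auto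
        have lag: "lag N m (t n) = (\<Prod>i\<in>{..<N} - {m}. t n - t i) / (\<Prod>i\<in>{..<N} - {m}. t m - t i)"
          by (simp add: lag_def prod_dividef)
        have "(\<Sum>i<N. lag N i (t n) * u i m) = (\<Sum>i<N. if i = m then lag N i (t n) / rt m else 0)"
          by (intro sum.cong) (auto simp: u_def)
        then have "g N n m = - lag N m (t n) / rt m"
          using m mn by (simp add: g_def u_def)
        moreover have "c m = 1 / ((t m - t n) * (\<Prod>i\<in>{..<N} - {m}. t m - t i) * rt m)"
          using cm[of m] mQ False by (simp add: QM)
        \<comment> \<open>The minus sign before the interpolation sum in \<open>g\<close> comes from
          this quotient; the other factors form \<open>lag N m (t n)\<close>.\<close>
        moreover have "(t n - t m) / (t m - t n) = - 1" using mn by (simp add: divide_eq_eq)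
        ultimately show ?thesis
          unfolding r_eq lag times_divide_eq_right mult_1_right
          by (simp add: divide_divide_eq_left[symmetric] times_divide_eq_left[symmetric]
              del: divide_divide_eq_left times_divide_eq_left)
      qed
    next
      case notQ: False
      then show ?thesis using g_support[of m n N] cm[of m] by (simp add: Q_def)
    qed
  qed
  moreover have "(\<lambda>z. r * E c z) \<in> H0"
    using H0 c by (simp add: nearly_invariant_def cdb_closed_subspace_def)
  ultimately show ?thesis by (simp add: E_scale c)
qed


section \<open>Finite codimension forces the weights to be summable\<close>

lemma g_l2seq [simp]: "l2seq (g N n)"
  by (rule l2seq_finite[of "insert n {..<N}"]) (use g_support[of _ n N] in auto)

text \<open>\<open>lag N 0\<close> has exact degree \<open>N - 1\<close>, so at distant nodes it is
  at least a constant times \<open>cmod (t n) ^ (N - 1)\<close>.\<close>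

lemma summable_weight_if_summable_lag:
  assumes N: "N \<ge> 1" and s: "summable (\<lambda>n. \<mu> n * (cmod (lag N 0 (t n)))\<^sup>2)"
  shows "summable (\<lambda>n. cmod (t n) ^ (2 * N - 2) * \<mu> n)"
proof (rule summable_comparison_test_ev)
  define J where "J = {..<N} - {0}"
  have J: "finite J" "card J = N - 1" using N by (auto simp: J_def)
  \<comment> \<open>At distant nodes \<open>cmod (t n - t j)\<close> is at least
    \<open>cmod (t n) / 2\<close>; \<open>\<kappa>\<close> collects these halves and the
    denominators of \<open>lag N 0\<close>.\<close>
  define \<kappa> where "\<kappa> = (\<Prod>j\<in>J. 1 / (2 * cmod (t 0 - t j)))"
  have \<kappa>: "\<kappa> > 0" unfolding \<kappa>_def by (intro prod_pos) (auto simp: J_def)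
  show "summable (\<lambda>n. (1 / \<kappa>\<^sup>2) * (\<mu> n * (cmod (lag N 0 (t n)))\<^sup>2))"
    by (intro summable_mult s)
  show "\<forall>\<^sub>F n in sequentially. norm (cmod (t n) ^ (2 * N - 2) * \<mu> n)
      \<le> (1 / \<kappa>\<^sup>2) * (\<mu> n * (cmod (lag N 0 (t n)))\<^sup>2)"
    using t_large[of "2 * (\<Sum>j\<in>J. cmod (t j))"]
  proof eventually_elim
    case (elim n)
    have "cmod (t n) ^ (N - 1) * \<kappa> = (\<Prod>j\<in>J. cmod (t n) * (1 / (2 * cmod (t 0 - t j))))"
      by (simp only: \<kappa>_def prod.distrib prod_constant J)
    also have "\<dots> \<le> (\<Prod>j\<in>J. cmod ((t n - t j) / (t 0 - t j)))"
    proof (intro prod_mono conjI)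
      fix j assume j: "j \<in> J"
      have "cmod (t j) \<le> (\<Sum>j\<in>J. cmod (t j))" using J j by (intro member_le_sum) auto
      then have "cmod (t n) / 2 \<le> cmod (t n - t j)"
        using elim norm_triangle_ineq2[of "t n" "t j"] by linarith
      then have "cmod (t n) / 2 * (1 / cmod (t 0 - t j)) \<le> cmod (t n - t j) * (1 / cmod (t 0 - t j))"
        by (rule mult_right_mono) simp
      then show "cmod (t n) * (1 / (2 * cmod (t 0 - t j))) \<le> cmod ((t n - t j) / (t 0 - t j))"
        by (simp add: norm_divide)
    qed simp
    also have "\<dots> = cmod (lag N 0 (t n))"
      by (simp add: lag_def J_def prod_norm)
    finally have "(cmod (t n) ^ (N - 1) * \<kappa>)\<^sup>2 \<le> (cmod (lag N 0 (t n)))\<^sup>2"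
      using \<kappa> by (intro power_mono) auto
    moreover have "(cmod (t n) ^ (N - 1))\<^sup>2 = cmod (t n) ^ (2 * N - 2)"
    proof -
      have "2 * N - 2 = (N - 1) * 2" by simp
      then show ?thesis by (simp only: power_mult)
    qed
    ultimately have "\<mu> n * (cmod (t n) ^ (2 * N - 2) * \<kappa>\<^sup>2) \<le> \<mu> n * (cmod (lag N 0 (t n)))\<^sup>2"
      using mu_pos[of n] by (intro mult_left_mono) (auto simp: power_mult_distrib)
    then show ?case using \<kappa> mu_pos[of n] by (simp add: field_simps)
  qed
qed

text \<open>By definition of \<open>g\<close>, each \<open>u i\<close> is \<open>g N i\<close> plus
  a combination of the first \<open>N\<close> of them, so the closed sum contains all unit vectors
  up to scale.\<close>

lemma l2plus_contains_all:
  assumes X: "l2subspace X" "l2closure X \<subseteq> X" and g: "\<And>n. g N n \<in> X" and c: "l2seq c"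
  shows "c \<in> l2plus X {..<N} u"
proof (rule l2_dense_units[OF l2subspace_plus[OF X(1)] l2closed_plus[OF X]])
  fix i
  have "u i \<in> l2plus X {..<N} u"
    using g[of i] unfolding l2plus_def g_def by (intro CollectI exI[of _ "\<lambda>k. lag N k (t i)"])
  then show "\<exists>a. a \<noteq> 0 \<and> (\<lambda>n. if n = i then a else 0) \<in> l2plus X {..<N} u"
    unfolding u_def[of i] by (intro exI[of _ "1 / rt i"]) (auto simp: if_distrib cong: if_cong)
qed (use c in auto)

text \<open>Otherwise \<open>u k\<close> could be eliminated and \<open>N - 1\<close> functions
  would span modulo \<open>X\<close>.\<close>

lemma codim_imp_not_in_plus:
  assumes X: "l2subspace X" "l2closure X \<subseteq> X" and cod: "cdb_codim t A \<mu> (E ` X) N"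
    and span: "\<And>c. l2seq c \<Longrightarrow> c \<in> l2plus X {..<N} u" and k: "k < N"
  shows "u k \<notin> l2plus X ({..<N} - {k}) u"
proof
  assume "u k \<in> l2plus X ({..<N} - {k}) u"
  then obtain b where b: "(\<lambda>n. u k n - (\<Sum>i\<in>{..<N} - {k}. b i * u i n)) \<in> X" by (auto simp: l2plus_def)
  have cs: "cdb_closed_subspace t A \<mu> (E ` X)"
    using X l2subspace_l2seq by (subst cdb_closed_subspace_E) auto
  have "N \<le> card ({..<N} - {k})"
  proof (rule codim_le_span[OF cs cod, where v = "\<lambda>i. E (u i)"])
    fix F assume "F \<in> cdb_space t A \<mu>"
    then obtain c where c: "l2seq c" "F = E c" by (rule cdb_spaceE)
    obtain a where a: "(\<lambda>n. c n - (\<Sum>i<N. a i * u i n)) \<in> X"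
      using span[OF c(1)] by (auto simp: l2plus_def)
    \<comment> \<open>The coefficients left after the combination given by \<open>b\<close> replaces
      \<open>u k\<close>.\<close>
    define d where "d i = a i + a k * b i" for i
    have "(\<lambda>n. (c n - (\<Sum>i<N. a i * u i n)) + a k * (u k n - (\<Sum>i\<in>{..<N} - {k}. b i * u i n))) \<in> X"
      by (intro l2subspace_add[OF X(1)] l2subspace_scale[OF X(1)] a b)
    moreover have "(c n - (\<Sum>i<N. a i * u i n)) + a k * (u k n - (\<Sum>i\<in>{..<N} - {k}. b i * u i n))
        = c n - (\<Sum>i\<in>{..<N} - {k}. d i * u i n)" for n
    proof -
      have "(\<Sum>i<N. a i * u i n) = a k * u k n + (\<Sum>i\<in>{..<N} - {k}. a i * u i n)"
        using k by (intro sum.remove) auto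
      then show ?thesis
        by (simp add: d_def algebra_simps sum.distrib sum_distrib_left)
    qed
    ultimately have "(\<lambda>n. c n - (\<Sum>i\<in>{..<N} - {k}. d i * u i n)) \<in> X" by simp
    then have "E (\<lambda>n. c n - (\<Sum>i\<in>{..<N} - {k}. d i * u i n)) \<in> E ` X" by blast
    then show "\<exists>b. (\<lambda>z. F z - (\<Sum>i\<in>{..<N} - {k}. b i * E (u i) z)) \<in> E ` X"
      using c by (auto simp: E_diff E_sum l2seq_sum)
  qed simp
  then show False using k by simp
qed

text \<open>Modulo \<open>K\<close>, every \<open>u n\<close> is \<open>lag N 0 (t n)\<close> times
  \<open>u 0\<close>, and the coordinate along \<open>u 0\<close> is bounded. Testing it on finitely
  supported sequences bounds the weighted square sum of the values of
  \<open>lag N 0\<close>.\<close>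

lemma summable_if_closed_codim:
  assumes N: "N \<ge> 1" and X: "l2subspace X" "l2closure X \<subseteq> X"
    and cod: "cdb_codim t A \<mu> (E ` X) N" and g: "\<And>n. g N n \<in> X"
  shows "summable (\<lambda>n. cmod (t n) ^ (2 * N - 2) * \<mu> n)"
proof (rule summable_weight_if_summable_lag[OF N])
  define K where "K = l2plus X ({..<N} - {0}) u"
  have K: "l2subspace K" "l2closure K \<subseteq> K"
    unfolding K_def by (intro l2subspace_plus l2closed_plus X; simp)+
  have "u 0 \<notin> K"
    unfolding K_def using codim_imp_not_in_plus[OF X cod l2plus_contains_all[OF X g]] N by auto
  from closed_dist_pos[OF K u_l2seq this] obtain \<delta> where \<delta>: "\<delta> > 0"
    "\<And>c a. l2seq c \<Longrightarrow> (\<lambda>n. c n - a * u 0 n) \<in> K \<Longrightarrow> \<delta> * cmod a \<le> l2norm c" by blast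
  have diff: "(\<lambda>m. u n m - lag N 0 (t n) * u 0 m) \<in> K" for n
  proof -
    have "(\<Sum>i<N. lag N i (t n) * u i m)
        = lag N 0 (t n) * u 0 m + (\<Sum>i\<in>{..<N} - {0}. lag N i (t n) * u i m)" for m
      using N by (intro sum.remove) auto
    then have "(\<lambda>m. (u n m - lag N 0 (t n) * u 0 m) - (\<Sum>i\<in>{..<N} - {0}. lag N i (t n) * u i m)) = g N n"
      by (simp add: g_def algebra_simps)
    then show ?thesis unfolding K_def l2plus_def using g[of n] by (intro CollectI exI[of _ "\<lambda>i. lag N i (t n)"]) simp
  qed
  define f where "f n = \<mu> n * (cmod (lag N 0 (t n)))\<^sup>2" for n
  have f0: "f n \<ge> 0" for n using mu_pos[of n] by (simp add: f_def)
  have "(\<Sum>n<M. f n) \<le> 1 / \<delta>\<^sup>2" for M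
  proof -
    \<comment> \<open>The extremal choice for Cauchy-Schwarz: the vector \<open>c\<close> has
      squared norm \<open>s\<close> and also coordinate \<open>s\<close>. Then
      \<open>\<delta> * s \<le> sqrt s\<close>, which bounds \<open>s\<close> independently of
      \<open>M\<close>.\<close>
    define x where "x n = \<mu> n * cnj (lag N 0 (t n))" for n
    define s where "s = (\<Sum>n<M. f n)"
    define c where "c m = (\<Sum>n<M. x n * u n m)" for m
    have "(\<lambda>m. \<Sum>n<M. x n * (u n m - lag N 0 (t n) * u 0 m)) \<in> K"
      by (intro l2subspace_sum[OF K(1)] diff) auto
    moreover have "(\<Sum>n<M. x n * (u n m - lag N 0 (t n) * u 0 m)) = c m - s * u 0 m" for m
    proof -
      have "x n * lag N 0 (t n) = f n" for n
        by (simp add: x_def f_def complex_norm_square[symmetric] mult.assoc mult.commute)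
      then have "x n * (u n m - lag N 0 (t n) * u 0 m) = x n * u n m - f n * u 0 m" for n
        by (simp add: right_diff_distrib mult.assoc[symmetric])
      then show ?thesis by (simp add: c_def s_def sum_subtractf sum_distrib_right)
    qed
    ultimately have "(\<lambda>m. c m - s * u 0 m) \<in> K" by simp
    moreover have "l2seq c" unfolding c_def by (intro l2seq_sum) auto
    ultimately have le: "\<delta> * cmod s \<le> l2norm c" by (intro \<delta>(2))
    have cm: "c m = (if m < M then rt m * cnj (lag N 0 (t m)) else 0)" for m
    proof -
      have "c m = (\<Sum>n<M. if n = m then x m / rt m else 0)"
        unfolding c_def by (intro sum.cong) (auto simp: u_def)
      moreover have "x m / rt m = rt m * cnj (lag N 0 (t m))"
        using mu_pos[of m] by (simp add: x_def field_simps flip: of_real_mult)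
      ultimately show ?thesis by simp
    qed
    have "(\<Sum>m. (cmod (c m))\<^sup>2) = (\<Sum>m<M. (cmod (c m))\<^sup>2)"
      by (rule suminf_finite) (auto simp: cm)
    also have "\<dots> = s"
      unfolding s_def f_def using mu_pos
      by (intro sum.cong) (auto simp: cm norm_mult power_mult_distrib less_imp_le)
    finally have "l2norm c = sqrt s" by (simp add: l2norm_def)
    moreover have s0: "s \<ge> 0" unfolding s_def by (intro sum_nonneg f0)
    ultimately have "\<delta> * s \<le> sqrt s" using le by simp
    then have "(\<delta> * s)\<^sup>2 \<le> s" using \<delta>(1) s0 by (metis real_sqrt_ge_0_iff real_sqrt_le_iff real_sqrt_pow2 power_mono mult_nonneg_nonneg less_imp_le)
    then have "s * (\<delta>\<^sup>2 * s) \<le> s * 1" by (simp add: power2_eq_square algebra_simps)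
    then have "\<delta>\<^sup>2 * s \<le> 1" using s0 by (cases "s = 0") auto
    then show ?thesis using \<delta>(1) by (simp add: s_def field_simps)
  qed
  then have "summable f" using f0 by (intro summableI_nonneg_bounded[of f "1 / \<delta>\<^sup>2"]) auto
  then show "summable (\<lambda>n. \<mu> n * (cmod (lag N 0 (t n)))\<^sup>2)" unfolding f_def[symmetric] .
qed

section \<open>Density of the span of the \<open>g\<close> among moment-free sequences\<close>

lemma moment_free_lag:
  assumes c: "c \<in> moment_free N" and "i < N"
  shows "(\<lambda>n. c n * rt n * lag N i (t n)) sums 0"
proof -
  obtain p where p: "degree p < N" "\<And>z. poly p z = lag N i z" using lag_poly[OF \<open>i < N\<close>] by blast
  have "(\<lambda>n. \<Sum>j\<le>degree p. coeff p j * (c n * rt n * t n ^ j)) sums (\<Sum>j\<le>degree p. coeff p j * 0)"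
    using c p(1) by (intro sums_sum sums_mult) (auto simp: moment_free_def)
  moreover have "(\<Sum>j\<le>degree p. coeff p j * (c n * rt n * t n ^ j)) = c n * rt n * lag N i (t n)" for n
    unfolding p(2)[symmetric] poly_altdef by (simp add: sum_distrib_left mult_ac)
  ultimately show ?thesis by simp
qed

text \<open>The truncation of \<open>c\<close> is the sum of \<open>c n * rt n * u n\<close>.
  Replacing each \<open>u n\<close> by \<open>g N n\<close> gives \<open>w M\<close> in
  \<open>X\<close>, at the cost of \<open>\<epsilon> M i\<close> times \<open>u i\<close> for
  \<open>i < N\<close>. These errors are partial sums of moments against \<open>lag N i\<close>, so
  they tend to zero.\<close>

lemma moment_free_subset:
  assumes X: "l2subspace X" "l2closure X \<subseteq> X" and g: "\<And>n. g N n \<in> X"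
  shows "moment_free N \<subseteq> X"
proof
  fix c assume c: "c \<in> moment_free N"
  then have l: "l2seq c" by (simp add: moment_free_def)
  define \<epsilon> where "\<epsilon> M i = (\<Sum>n<M. c n * rt n * lag N i (t n))" for M i
  define w where "w M m = (\<Sum>n<M. (c n * rt n) * g N n m)" for M m
  have wX: "w M \<in> X" for M
    unfolding w_def by (intro l2subspace_sum[OF X(1)] g) auto
  have w_eq: "w M m - c m = (-1) * ((if m < M then 0 else c m) + (\<Sum>i<N. \<epsilon> M i * u i m))" for M m
  proof -
    have "w M m = (\<Sum>n<M. c n * rt n * u n m) - (\<Sum>n<M. \<Sum>i<N. c n * rt n * lag N i (t n) * u i m)"
      by (simp add: w_def g_def right_diff_distrib sum_subtractf sum_distrib_left mult.assoc)
    also have "(\<Sum>n<M. c n * rt n * u n m) = (\<Sum>n<M. if n = m then c m else 0)"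
      by (intro sum.cong) (auto simp: u_def)
    also have "(\<Sum>n<M. \<Sum>i<N. c n * rt n * lag N i (t n) * u i m) = (\<Sum>i<N. \<epsilon> M i * u i m)"
      by (subst sum.swap) (simp add: \<epsilon>_def sum_distrib_right)
    finally show ?thesis by simp
  qed
  have tail: "l2seq (\<lambda>m. if m < M then 0 else c m)" for M
    by (rule l2seq_comparison[OF l, of _ 1]) auto
  have bound: "l2norm (\<lambda>m. w M m - c m)
      \<le> l2norm (\<lambda>m. if m < M then 0 else c m) + (\<Sum>i<N. cmod (\<epsilon> M i) * l2norm (u i))" for M
  proof -
    have s: "l2seq (\<lambda>m. \<Sum>i<N. \<epsilon> M i * u i m)" by (intro l2seq_sum) auto
    have "l2norm (\<lambda>m. w M m - c m) = l2norm (\<lambda>m. (if m < M then 0 else c m) + (\<Sum>i<N. \<epsilon> M i * u i m))"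
      unfolding w_eq l2norm_scale[OF l2seq_add[OF tail s]] by simp
    also have "\<dots> \<le> l2norm (\<lambda>m. if m < M then 0 else c m) + l2norm (\<lambda>m. \<Sum>i<N. \<epsilon> M i * u i m)"
      by (rule l2norm_triangle[OF tail s])
    also have "l2norm (\<lambda>m. \<Sum>i<N. \<epsilon> M i * u i m) \<le> (\<Sum>i<N. cmod (\<epsilon> M i) * l2norm (u i))"
      by (rule l2norm_sum_le) auto
    finally show ?thesis by simp
  qed
  have \<epsilon>0: "(\<lambda>M. \<epsilon> M i) \<longlonglongrightarrow> 0" if "i < N" for i
    using moment_free_lag[OF c that] by (simp add: sums_def \<epsilon>_def)
  have "(\<lambda>M. l2norm (\<lambda>m. if m < M then 0 else c m) + (\<Sum>i<N. cmod (\<epsilon> M i) * l2norm (u i)))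
      \<longlonglongrightarrow> 0 + (\<Sum>i<N. cmod 0 * l2norm (u i))"
    by (intro tendsto_intros l2norm_tail l \<epsilon>0) auto
  then have lim: "(\<lambda>M. l2norm (\<lambda>m. if m < M then 0 else c m) + (\<Sum>i<N. cmod (\<epsilon> M i) * l2norm (u i)))
      \<longlonglongrightarrow> 0" by simp
  have "\<exists>d\<in>X. l2norm (\<lambda>m. d m - c m) < e" if e: "e > 0" for e
  proof -
    obtain M where "l2norm (\<lambda>m. if m < M then 0 else c m) + (\<Sum>i<N. cmod (\<epsilon> M i) * l2norm (u i)) < e"
      using eventually_happens'[OF sequentially_bot order_tendstoD(2)[OF lim e]] by blast
    then have "l2norm (\<lambda>m. w M m - c m) < e" using bound[of M] by linarith
    then show ?thesis using wX by (intro bexI[of _ "w M"])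
  qed
  then have "c \<in> l2closure X" using l unfolding l2closure_def by blast
  then show "c \<in> X" using X by blast
qed

subsection \<open>Sequences with vanishing moments\<close>

text \<open>Places the domain between the \<open>g\<close> and \<open>moment_free N\<close> before
  (iii) is known; both inclusions are needed to compute its closure.\<close>

lemma D_zpow_eq:
  "\<exists>Y. D_zpow t A \<mu> N = E ` Y \<and> l2subspace Y \<and> Y \<subseteq> moment_free N \<and> (\<forall>n. g N n \<in> Y)"
proof (intro exI conjI allI)
  define Y where "Y = {c. l2seq c \<and> E c \<in> D_zpow t A \<mu> N}"
  show "D_zpow t A \<mu> N = E ` Y"
    by (auto simp: Y_def D_zpow_def elim!: cdb_spaceE)
  show "Y \<subseteq> moment_free N"
    using D_zpow_moment_free by (fastforce simp: Y_def)
  show "g N n \<in> Y" for n using g_in_D_zpow by (simp add: Y_def)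
  have mem: "c \<in> Y \<longleftrightarrow> l2seq c \<and> (\<exists>d. l2seq d \<and> (\<forall>z. z ^ N * E c z = E d z))" for c
    by (auto simp: Y_def D_zpow_def cdb_space_eq image_iff fun_eq_iff)
  show "l2subspace Y"
    unfolding l2subspace_def
  proof (intro conjI ballI allI)
    fix c assume "c \<in> Y"
    then obtain d where d: "l2seq c" "l2seq d" "\<And>z. z ^ N * E c z = E d z" using mem by blast
    then show "l2seq c" by simp
    fix a
    show "(\<lambda>n. a * c n) \<in> Y"
      unfolding mem using d
      by (intro conjI exI[of _ "\<lambda>n. a * d n"]) (auto simp: E_scale l2seq_scale d(3)[symmetric])
  next
    fix c c' assume "c \<in> Y" "c' \<in> Y"
    then obtain d d' where d: "l2seq c" "l2seq d" "\<And>z. z ^ N * E c z = E d z"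
      "l2seq c'" "l2seq d'" "\<And>z. z ^ N * E c' z = E d' z" using mem by metis
    then show "(\<lambda>n. c n + c' n) \<in> Y"
      unfolding mem 
      by (intro conjI exI[of _ "\<lambda>n. d n + d' n"])
         (auto simp: E_add l2seq_add distrib_left)
  next
    show "(\<lambda>n. 0) \<in> Y" unfolding mem by (intro conjI exI[of _ "\<lambda>n. 0"]) auto
  qed
qed

text \<open>Condition (iii) is the case \<open>j = N - 1\<close>; lower powers are dominated by it
  at nodes of modulus above 1.\<close>

lemma weight_l2seq:
  assumes iii: "summable (\<lambda>n. cmod (t n) ^ (2 * N - 2) * \<mu> n)" and "j < N"
  shows "l2seq (\<lambda>n. rt n * t n ^ j)"
proof (rule l2seq_comparison)
  have "(cmod (rt n * t n ^ (N - 1)))\<^sup>2 = cmod (t n) ^ (2 * N - 2) * \<mu> n" for n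
  proof -
    have "(cmod (t n) ^ (N - 1))\<^sup>2 = cmod (t n) ^ (2 * N - 2)"
    proof -
      have "2 * N - 2 = (N - 1) * 2" by simp
      then show ?thesis by (simp only: power_mult)
    qed
    then show ?thesis using mu_pos[of n] by (simp add: norm_mult norm_power power_mult_distrib)
  qed
  then show "l2seq (\<lambda>n. rt n * t n ^ (N - 1))" using iii by (simp add: l2seq_def)
  show "\<forall>\<^sub>F n in sequentially. cmod (rt n * t n ^ j) \<le> 1 * cmod (rt n * t n ^ (N - 1))"
    using t_large[of 1]
  proof eventually_elim
    case (elim n)
    then have "cmod (t n) ^ j \<le> cmod (t n) ^ (N - 1)" using \<open>j < N\<close> by (intro power_increasing) auto
    then show ?case by (simp add: norm_mult norm_power mult_left_mono)
  qed
qed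

section \<open>The moment-free space under the summability condition\<close>

context
  fixes N :: nat
  assumes iii: "summable (\<lambda>n. cmod (t n) ^ (2 * N - 2) * \<mu> n)"
begin

lemma moment_summable: "l2seq c \<Longrightarrow> j < N \<Longrightarrow> summable (\<lambda>n. c n * rt n * t n ^ j)"
  using l2_mult_summable[OF _ weight_l2seq[OF iii]] by (simp add: mult.assoc)

lemma moment_free_iff: "c \<in> moment_free N \<longleftrightarrow> l2seq c \<and> (\<forall>j<N. (\<Sum>n. c n * rt n * t n ^ j) = 0)"
  using moment_summable[of c] by (auto simp: moment_free_def sums_iff)

lemma moment_free_subspace: "l2subspace (moment_free N)"
  unfolding l2subspace_def
proof (intro conjI ballI allI)
  fix c a assume c: "c \<in> moment_free N"
  then show "l2seq c" by (simp add: moment_free_def)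
  show "(\<lambda>n. a * c n) \<in> moment_free N"
    using c sums_mult[of _ 0 a] by (auto simp: moment_free_def l2seq_scale mult.assoc)
next
  fix c d assume "c \<in> moment_free N" "d \<in> moment_free N"
  then show "(\<lambda>n. c n + d n) \<in> moment_free N"
    using sums_add[of _ 0 _ 0] by (auto simp: moment_free_def l2seq_add distrib_right)
qed (simp add: moment_free_def)

text \<open>Each moment is a continuous functional, by Cauchy-Schwarz against the square summable
  weight \<open>rt n * t n ^ j\<close>.\<close>

lemma moment_free_closed: "l2closure (moment_free N) \<subseteq> moment_free N"
proof
  fix c assume c: "c \<in> l2closure (moment_free N)"
  then have l: "l2seq c" by (simp add: l2closure_def)
  have "(\<Sum>n. c n * rt n * t n ^ j) = 0" if j: "j < N" for j
  proof (rule ccontr)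
    assume nz: "(\<Sum>n. c n * rt n * t n ^ j) \<noteq> 0" (is "?m \<noteq> 0")
    \<comment> \<open>The added 1 keeps the bound positive, so that it can be divided by.\<close>
    define B where "B = l2norm (\<lambda>n. rt n * t n ^ j) + 1"
    have B: "B > 0" using l2norm_nonneg[OF weight_l2seq[OF iii j]] by (simp add: B_def)
    have "cmod ?m / B > 0" using nz B by simp
    then obtain d where d: "d \<in> moment_free N" "l2norm (\<lambda>n. d n - c n) < cmod ?m / B"
      using l2closureE[OF c] by blast
    have ld: "l2seq d" using d by (simp add: moment_free_def)
    have "(\<lambda>n. d n * rt n * t n ^ j - c n * rt n * t n ^ j) sums (0 - ?m)"
      using d j l by (intro sums_diff summable_sums moment_summable) (auto simp: moment_free_def)
    then have "(\<lambda>n. (d n - c n) * (rt n * t n ^ j)) sums (- ?m)"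
      by (simp add: algebra_simps)
    then have "cmod ?m = cmod (\<Sum>n. (d n - c n) * (rt n * t n ^ j))" by (simp add: sums_iff)
    also have "\<dots> \<le> l2norm (\<lambda>n. d n - c n) * l2norm (\<lambda>n. rt n * t n ^ j)"
      by (rule l2_cauchy_schwarz[OF l2seq_diff[OF ld l] weight_l2seq[OF iii j]])
    also have "\<dots> \<le> l2norm (\<lambda>n. d n - c n) * B"
      using l2norm_nonneg[OF l2seq_diff[OF ld l]] by (intro mult_left_mono) (auto simp: B_def)
    also have "\<dots> < cmod ?m" using d(2) B by (simp add: field_simps)
    finally show False by simp
  qed
  then show "c \<in> moment_free N" using l by (simp add: moment_free_iff)
qed

lemma moment_free_plus:
  assumes c: "l2seq c"
  shows "c \<in> l2plus (moment_free N) {..<N} u"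
proof -
  note X = moment_free_subspace moment_free_closed
  show ?thesis
    by (rule l2plus_contains_all[OF X _ c]) (auto simp: moment_free_def intro: g_moment)
qed

text \<open>The functional weighting \<open>c n * rt n\<close> with \<open>lag N k (t n)\<close>
  kills moment-free sequences and reads off \<open>a k\<close> from a combination of the first
  \<open>u i\<close>.\<close>

lemma moment_free_independent:
  assumes "(\<lambda>n. \<Sum>i<N. a i * u i n) \<in> moment_free N" "k < N"
  shows "a k = 0"
proof -
  let ?c = "\<lambda>n. \<Sum>i<N. a i * u i n"
  have 1: "(\<lambda>n. ?c n * rt n * lag N k (t n)) sums 0" by (rule moment_free_lag[OF assms])
  have "?c n = (\<Sum>i<N. if i = n then a i / rt n else 0)" for n
    by (intro sum.cong) (auto simp: u_def)
  then have cn: "?c n = (if n < N then a n / rt n else 0)" for n by simp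
  have "?c n * rt n * lag N k (t n) = (if n = k then a n else 0)" for n
    unfolding cn using assms(2) by (auto simp: lag_node)
  then have "(\<lambda>n. if n = k then a n else 0) sums 0" using 1 by simp
  moreover have "(\<lambda>n. if n = k then a n else 0) sums a k" by (rule sums_single)
  ultimately show ?thesis by (metis sums_unique2)
qed

lemma moment_free_codim: "cdb_codim t A \<mu> (E ` moment_free N) N"
proof -
  define S where "S = (\<lambda>i. E (u i)) ` {..<N}"
  have "u i = u j \<Longrightarrow> i = j" for i j
    by (auto simp: u_def fun_eq_iff split: if_splits)
  then have inj: "inj_on (\<lambda>i. E (u i)) {..<N}" by (auto intro!: inj_onI)
  have sumS: "(\<Sum>s\<in>S. a s * s z) = (\<Sum>i<N. a (E (u i)) * E (u i) z)" for a z
    unfolding S_def by (subst sum.reindex[OF inj]) simp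
  have img: "E c \<in> E ` moment_free N \<longleftrightarrow> c \<in> moment_free N" for c
    by (simp add: inj_image_mem_iff inj_def)
  show ?thesis
    unfolding cdb_codim_def
  proof (intro exI[of _ S] conjI allI impI ballI)
    show "finite S" "card S = N" "S \<subseteq> cdb_space t A \<mu>"
      using card_image[OF inj] by (auto simp: S_def)
    fix a s assume "(\<lambda>z. \<Sum>s\<in>S. a s * s z) \<in> E ` moment_free N" and s: "s \<in> S"
    then have "E (\<lambda>n. \<Sum>i<N. a (E (u i)) * u i n) \<in> E ` moment_free N"
      by (simp add: sumS E_sum)
    then have "(\<lambda>n. \<Sum>i<N. a (E (u i)) * u i n) \<in> moment_free N" unfolding img .
    from moment_free_independent[OF this] show "a s = 0" using s by (auto simp: S_def)
  next
    fix F assume "F \<in> cdb_space t A \<mu>"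
    then obtain c where c: "l2seq c" "F = E c" by (rule cdb_spaceE)
    obtain a where a: "(\<lambda>n. c n - (\<Sum>i<N. a i * u i n)) \<in> moment_free N"
      using moment_free_plus[OF c(1)] by (auto simp: l2plus_def)
    \<comment> \<open>\<open>cdb_codim\<close> indexes coefficients by the functions themselves, so
      \<open>a\<close> is transported along the injective enumeration of \<open>S\<close>.\<close>
    define b where "b = a \<circ> the_inv_into {..<N} (\<lambda>i. E (u i))"
    have "(\<Sum>s\<in>S. b s * s z) = (\<Sum>i<N. a i * E (u i) z)" for z
      unfolding sumS by (intro sum.cong) (simp_all add: b_def the_inv_into_f_f[OF inj])
    moreover have "E (\<lambda>n. c n - (\<Sum>i<N. a i * u i n)) \<in> E ` moment_free N" using a by blast
    ultimately show "\<exists>a. (\<lambda>z. F z - (\<Sum>s\<in>S. a s * s z)) \<in> E ` moment_free N"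
      using c by (intro exI[of _ b]) (simp add: E_diff E_sum l2seq_sum)
  qed
qed

text \<open>For the quotient sequence \<open>y\<close>, moment \<open>j + 1\<close> is moment
  \<open>j\<close> of \<open>c\<close> plus \<open>w\<close> times moment \<open>j\<close> of
  \<open>y\<close>. Induction starts at the zeroth moment, which \<open>E_root_quotient\<close>
  supplies.\<close>

lemma moment_free_nearly_invariant: "nearly_invariant t A \<mu> (E ` moment_free N)"
  unfolding nearly_invariant_def
proof (intro conjI ballI allI impI)
  show "cdb_closed_subspace t A \<mu> (E ` moment_free N)"
    using moment_free_subspace moment_free_closed by (subst cdb_closed_subspace_E) (auto simp: moment_free_def)
  fix f w assume "f \<in> E ` moment_free N" and root: "f w = 0"
  then obtain c where c: "c \<in> moment_free N" "f = E c" by blast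
  have l: "l2seq c" using c by (simp add: moment_free_def)
  have "E c w = 0" using root c(2) by simp
  then obtain y where y: "l2seq y" "\<And>n. c n = (t n - w) * y n" "(\<lambda>n. y n * rt n) sums 0"
    "(\<lambda>z. if z = w then deriv (E c) w else E c z / (z - w)) = E y"
    using E_root_quotient[OF l] by blast
  have "j < N \<Longrightarrow> (\<lambda>n. y n * rt n * t n ^ j) sums 0" for j
  proof (induction j)
    case (Suc j)
    then have "(\<lambda>n. c n * rt n * t n ^ j + w * (y n * rt n * t n ^ j)) sums (0 + w * 0)"
      using c by (intro sums_add sums_mult) (auto simp: moment_free_def)
    moreover have "c n * rt n * t n ^ j + w * (y n * rt n * t n ^ j) = y n * rt n * t n ^ Suc j" for n
      by (simp add: y(2) algebra_simps)
    ultimately show ?case by simp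
  qed (use y(3) in simp)
  then have "y \<in> moment_free N" using y(1) by (simp add: moment_free_def)
  then show "(\<lambda>z. if z = w then deriv f w else f z / (z - w)) \<in> E ` moment_free N"
    using y(4) c(2) by auto
qed

text \<open>An element of \<open>X\<close> differs from a moment-free sequence by a combination of
  the first \<open>u i\<close> that lies in \<open>X\<close>. A nonzero coefficient would express
  some \<open>u k\<close> by the others modulo \<open>X\<close>, against the codimension.\<close>

lemma moment_free_maximal:
  assumes X: "l2subspace X" "l2closure X \<subseteq> X" and cod: "cdb_codim t A \<mu> (E ` X) N"
    and sub: "moment_free N \<subseteq> X"
  shows "X = moment_free N"
proof (rule antisym[OF _ sub], rule subsetI)
  fix c assume c: "c \<in> X"
  have span: "d \<in> l2plus X {..<N} u" if "l2seq d" for d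
    using moment_free_plus[OF that] sub by (auto simp: l2plus_def)
  obtain a where a: "(\<lambda>n. c n - (\<Sum>i<N. a i * u i n)) \<in> moment_free N"
    using moment_free_plus[OF l2subspace_l2seq[OF X(1) c]] by (auto simp: l2plus_def)
  then have diff: "(\<lambda>n. \<Sum>i<N. a i * u i n) \<in> X"
    using l2subspace_diff[OF X(1) c, of "\<lambda>n. c n - (\<Sum>i<N. a i * u i n)"] sub by auto
  have "a k = 0" if k: "k < N" for k
  proof (rule ccontr)
    assume nz: "a k \<noteq> 0"
    have "(\<lambda>n. (1 / a k) * (\<Sum>i<N. a i * u i n)) \<in> X" by (rule l2subspace_scale[OF X(1) diff])
    moreover have "(1 / a k) * (\<Sum>i<N. a i * u i n)
        = u k n - (\<Sum>i\<in>{..<N} - {k}. (- a i / a k) * u i n)" for n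
    proof -
      have "(\<Sum>i<N. a i * u i n) = a k * u k n + (\<Sum>i\<in>{..<N} - {k}. a i * u i n)"
        using k by (intro sum.remove) auto
      then show ?thesis using nz
        by (simp add: distrib_left sum_distrib_left sum_negf)
    qed
    ultimately have "u k \<in> l2plus X ({..<N} - {k}) u"
      unfolding l2plus_def by (intro CollectI exI[of _ "\<lambda>i. - a i / a k"]) simp
    then show False using codim_imp_not_in_plus[OF X cod span k] by blast
  qed
  then show "c \<in> moment_free N" using a by simp
qed

text \<open>Condition (iii) makes the coefficients of \<open>B_fun t A \<mu> j\<close> square
  summable, so \<open>cdb_coeff\<close> recovers them and the inner product is the
  \<open>j\<close>-th moment.\<close>

lemma moment_free_orthogonal:
  "E ` moment_free N = {F \<in> cdb_space t A \<mu>. \<forall>j<N. cdb_inner t A \<mu> F (B_fun t A \<mu> j) = 0}"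
proof -
  have "cdb_inner t A \<mu> (E c) (B_fun t A \<mu> j) = (\<Sum>n. c n * rt n * t n ^ j)" if "l2seq c" "j < N" for c j
  proof -
    have "cmod (cnj (t n) ^ j * rt n) = cmod (rt n * t n ^ j)" for n
      by (simp add: norm_mult norm_power)
    then have "l2seq (\<lambda>n. cnj (t n) ^ j * rt n)"
      using weight_l2seq[OF iii that(2)] unfolding l2seq_def by simp
    then show ?thesis using that by (simp add: cdb_inner_def B_fun_def mult_ac)
  qed
  then show ?thesis by (auto simp: moment_free_iff cdb_space_eq)
qed

end

end

section \<open>The equivalences, uniqueness and the orthogonal description\<close>

theorem theorem1p8:
  fixes t :: "nat \<Rightarrow> complex" and \<mu> :: "nat \<Rightarrow> real" and A :: "complex \<Rightarrow> complex"
    and N :: nat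
  assumes t_inj: "inj t"
    and t_inf: "filterlim (\<lambda>n. cmod (t n)) at_top sequentially"
    and mu_pos: "\<And>n. \<mu> n > 0"
    and mu_sum: "summable (\<lambda>n. \<mu> n / ((cmod (t n))\<^sup>2 + 1))"
    and A_entire: "A holomorphic_on UNIV"
    and A_zeros: "\<And>z. A z = 0 \<longleftrightarrow> z \<in> range t"
    and A_simple: "\<And>n. deriv A (t n) \<noteq> 0"
    and N_pos: "N \<ge> 1"
  shows "((\<exists>H0. nearly_invariant t A \<mu> H0 \<and> cdb_codim t A \<mu> H0 N)
            \<longleftrightarrow> cdb_codim t A \<mu> (cdb_closure t A \<mu> (D_zpow t A \<mu> N)) N)
       \<and> (cdb_codim t A \<mu> (cdb_closure t A \<mu> (D_zpow t A \<mu> N)) N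
            \<longleftrightarrow> summable (\<lambda>n. (cmod (t n)) ^ (2 * N - 2) * \<mu> n))
       \<and> (summable (\<lambda>n. (cmod (t n)) ^ (2 * N - 2) * \<mu> n) \<longrightarrow>
            (\<forall>H0. (nearly_invariant t A \<mu> H0 \<and> cdb_codim t A \<mu> H0 N)
                    \<longleftrightarrow> H0 = cdb_closure t A \<mu> (D_zpow t A \<mu> N))
          \<and> cdb_closure t A \<mu> (D_zpow t A \<mu> N) =
              {F \<in> cdb_space t A \<mu>. \<forall>j<N. cdb_inner t A \<mu> F (B_fun t A \<mu> j) = 0})"
proof -
  interpret cauchy_de_branges t \<mu> A
    by unfold_locales (fact assms)+
  let ?iii = "summable (\<lambda>n. (cmod (t n)) ^ (2 * N - 2) * \<mu> n)"
  let ?D = "cdb_closure t A \<mu> (D_zpow t A \<mu> N)"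
  obtain Y where Y: "D_zpow t A \<mu> N = E ` Y" "l2subspace Y" "Y \<subseteq> moment_free N" "\<And>n. g N n \<in> Y"
    using D_zpow_eq by blast
  have Yl2: "\<forall>c\<in>Y. l2seq c" using l2subspace_l2seq[OF Y(2)] by blast
  have D: "?D = E ` l2closure Y" unfolding Y(1) by (rule cdb_closure_E[OF Yl2])
  note clY = l2subspace_closure[OF Y(2)] l2closure_idem[OF Yl2]
  have gY: "g N n \<in> l2closure Y" for n using Y(4) l2closure_superset[OF Yl2] by blast
  \<comment> \<open>Containing every \<open>g N n\<close> is the one consequence of near invariance
    that both (iii) and uniqueness are derived from.\<close>
  have contains: "\<exists>X. H0 = E ` X \<and> l2subspace X \<and> l2closure X \<subseteq> X \<and> (\<forall>n. g N n \<in> X)"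
    if H0: "nearly_invariant t A \<mu> H0" "cdb_codim t A \<mu> H0 N" for H0
  proof -
    have "cdb_closed_subspace t A \<mu> H0" using H0 by (simp add: nearly_invariant_def)
    then obtain X where X: "H0 = E ` X" "l2subspace X" "l2closure X \<subseteq> X" by (rule closed_subspaceE)
    have "g N n \<in> X" for n
      using nearly_invariant_contains_g[OF H0, of n] X(1) by auto
    then show ?thesis using X by blast
  qed
  have i_iii: ?iii if H0: "nearly_invariant t A \<mu> H0" "cdb_codim t A \<mu> H0 N" for H0
  proof -
    obtain X where X: "H0 = E ` X" "l2subspace X" "l2closure X \<subseteq> X" "\<And>n. g N n \<in> X"
      using contains[OF H0] by blast
    show ?thesis
      using summable_if_closed_codim[OF N_pos X(2,3) _ X(4)] H0(2) X(1) by simp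
  qed
  \<comment> \<open>The closure of the domain is itself a closed subspace containing the
    \<open>g\<close>, so the argument for (i) applies to it.\<close>
  have ii_iii: ?iii if "cdb_codim t A \<mu> ?D N"
    using summable_if_closed_codim[OF N_pos clY _ gY] that D by simp
  \<comment> \<open>One inclusion is closedness of \<open>moment_free N\<close>, the other is
    density of the span of the \<open>g\<close>, which lie in the domain.\<close>
  have D_eq: "?D = E ` moment_free N" if iii: ?iii
  proof -
    have "l2closure Y \<subseteq> moment_free N"
      using l2closure_mono[OF Y(3)] moment_free_closed[OF iii] by blast
    moreover have "moment_free N \<subseteq> l2closure Y"
      by (rule moment_free_subset[OF clY gY])
    ultimately show ?thesis unfolding D by auto
  qed
  have unique: "H0 = ?D" if iii: ?iii and H0: "nearly_invariant t A \<mu> H0" "cdb_codim t A \<mu> H0 N" for H0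
  proof -
    obtain X where X: "H0 = E ` X" "l2subspace X" "l2closure X \<subseteq> X" "\<And>n. g N n \<in> X"
      using contains[OF H0] by blast
    have "X = moment_free N"
      using moment_free_maximal[OF iii X(2,3)] H0(2) X(1) moment_free_subset[OF X(2-4)] by simp
    then show ?thesis using D_eq[OF iii] X(1) by simp
  qed
  have ni: "nearly_invariant t A \<mu> ?D" "cdb_codim t A \<mu> ?D N" if iii: ?iii
    unfolding D_eq[OF iii]
    using moment_free_nearly_invariant[OF iii] moment_free_codim[OF iii] by auto
  have i_iff: "(\<exists>H0. nearly_invariant t A \<mu> H0 \<and> cdb_codim t A \<mu> H0 N) \<longleftrightarrow> ?iii"
  proof (rule iffI)
    assume ?iii
    then show "\<exists>H0. nearly_invariant t A \<mu> H0 \<and> cdb_codim t A \<mu> H0 N"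
      by (intro exI[of _ ?D] conjI ni)
  qed (elim exE conjE, rule i_iii)
  have ii_iff: "cdb_codim t A \<mu> ?D N \<longleftrightarrow> ?iii"
    by (rule iffI[OF ii_iii ni(2)])
  have iii_imp: "\<forall>H0. (nearly_invariant t A \<mu> H0 \<and> cdb_codim t A \<mu> H0 N) \<longleftrightarrow> H0 = ?D" if iii: ?iii
  proof (intro allI iffI)
    fix H0 assume "nearly_invariant t A \<mu> H0 \<and> cdb_codim t A \<mu> H0 N"
    then show "H0 = ?D" by (elim conjE) (rule unique[OF iii])
  next
    fix H0 assume "H0 = ?D"
    with ni[OF iii] show "nearly_invariant t A \<mu> H0 \<and> cdb_codim t A \<mu> H0 N" by simp
  qed
  have orth: "?D = {F \<in> cdb_space t A \<mu>. \<forall>j<N. cdb_inner t A \<mu> F (B_fun t A \<mu> j) = 0}" if iii: ?iii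
    unfolding D_eq[OF iii] by (rule moment_free_orthogonal[OF iii])
  show ?thesis
    unfolding i_iff ii_iff by (intro conjI impI refl iii_imp orth)
qed

end
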